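(* Let $A$ be a closed symmetric relation in a separable Hilbert space $\mathcal H$ and let $\{\mathcal G,\Gamma_0,\Gamma_1\}$ be a quasi boundary triple for $A^*$ with $A_0=\ker\Gamma_0$, $\gamma$-field $\gamma$ and Weyl function $M$. Let $\mathfrak A$ be a class of operator ideals and let $\Theta$ be a self-adjoint relation in $\mathcal G$ such that the following conditions hold: (i) $\overline{M(\lambda_0)}\in\mathfrak S_\infty(\mathcal G)$ for some $\lambda_0\in\mathbb C\setminus\mathbb R$; (ii) $\gamma(\lambda_1)^*\in\mathfrak A^*(\mathcal H,\mathcal G)$ for some $\lambda_1\in\rho(A_0)$; (iii) $0\notin\sigma_{\rm ess}(\Theta)$ and $A_\Theta=A_\Theta^*$. Then $$(A_\Theta-\lambda)^{-1}-(A_0-\lambda)^{-1}\in(\mathfrak A\cdot\mathfrak A^* )(\mathcal H)$$ for all $\lambda\in\rho(A_\Theta)\cap\rho(A_0)$.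
   Context: Linear relations. A (closed) linear relation in a Hilbert space $\mathcal H$ is a (closed) linear subspace of $\mathcal H\times\mathcal H$; elements are written $\hat f=\binom{f}{f'}$, and operators are identified with their graphs. $\operatorname{dom}S=\{f:\exists f',\binom f{f'}\in S\}$, $\ker S=\{f:\binom f0\in S\}$, $\operatorname{mul}S=\{f':\binom0{f'}\in S\}$, $S-\lambda=\{\binom{f}{f'-\lambda f}:\binom f{f'}\in S\}$. For closed $S$, $\rho(S)$ is the set of $\lambda\in\mathbb C$ such that $(S-\lambda)^{-1}$ is a bounded everywhere defined operator. The adjoint is $S^*=\{\binom g{g'}:(f',g)=(f,g')\text{ for all }\binom f{f'}\in S\}$; $S$ is symmetric if $S\subset S^*$ and self-adjoint if $S=S^*$. A self-adjoint relation $S$ decomposes as $S=S_{\rm op}\oplus S_\infty$, where $S_{\rm op}$ is a self-adjoint operator in $\overline{\operatorname{dom}S}=(\operatorname{mul}S)^\perp$ and $S_\infty=\{\binom0{f'}:f'\in\operatorname{mul}S\}$; $\sigma_{\rm ess}(S):=\sigma_{\rm ess}(S_{\rm op})$, where the essential spectrum of a closed operator $R$ is the set of $\lambda$ such that $R-\lambda$ is not Fredholm. Quasi boundary triples. Let $A$ be a closed symmetric relation in $\mathcal H$. $\{\mathcal G,\Gamma_0,\Gamma_1\}$ is a quasi boundary triple for $A^*$ if $\mathcal G$ is a Hilbert space and $\Gamma_0,\Gamma_1:T\to\mathcal G$ are linear mappings defined on a dense subspace $T$ of $A^*$ (dense in $A^*$ with respect to the topology of $\mathcal H\times\mathcal H$)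 such that $\Gamma=\binom{\Gamma_0}{\Gamma_1}:T\to\mathcal G\times\mathcal G$ has dense range, $\ker\Gamma_0$ is a self-adjoint relation in $\mathcal H$, and $(f',g)-(f,g')=(\Gamma_1\hat f,\Gamma_0\hat g)-(\Gamma_0\hat f,\Gamma_1\hat g)$ for all $\hat f=\binom f{f'},\hat g=\binom g{g'}\in T$. If $\mathcal H$ is separable, so is $\mathcal G$. For a linear relation $\Theta$ in $\mathcal G$ put $A_\Theta=\{\hat f\in T:\Gamma\hat f\in\Theta\}$. $\gamma$-field and Weyl function. Let $A_0=\ker\Gamma_0$ and $\mathcal G_0=\operatorname{ran}\Gamma_0$ (dense in $\mathcal G$). For $\lambda\in\rho(A_0)$ let $\hat{\mathcal N}_{\lambda,T}=\{\binom{f}{\lambda f}: f\in\ker(T-\lambda)\}$; then $\Gamma_0$ restricted to $\hat{\mathcal N}_{\lambda,T}$ is a bijection onto $\mathcal G_0$. With $\pi_1$ the projection of $\mathcal H\times\mathcal H$ onto the first component, define $\gamma(\lambda)=\pi_1(\Gamma_0\upharpoonright\hat{\mathcal N}_{\lambda,T})^{-1}:\mathcal G_0\to\mathcal H$ and $M(\lambda)=\Gamma_1(\Gamma_0\upharpoonright\hat{\mathcal N}_{\lambda,T})^{-1}:\mathcal G_0\to\mathcal G$, regarded as densely defined operators with domain $\mathcal G_0\subset\mathcal G$. $\gamma(\lambda)$ is bounded, so $\gamma(\lambda)^*\in\mathcal B(\mathcal H,\mathcal G)$; $M(\lambda)$ is closable in $\mathcal G$ with closure $\overline{M(\lambda)}$.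 Operator ideals. All Hilbert spaces here are separable; $\mathcal B(\mathcal H,\mathcal K)$ are the bounded, $\mathfrak S_\infty(\mathcal H,\mathcal K)$ the compact operators, $\mathfrak S_\infty(\mathcal H)=\mathfrak S_\infty(\mathcal H,\mathcal H)$. A class of operator ideals $\mathfrak A$ consists of subsets $\mathfrak A(\mathcal H,\mathcal K)\subset\mathfrak S_\infty(\mathcal H,\mathcal K)$ for every pair of Hilbert spaces, such that: rank-one operators $x\mapsto(x,u)v$ lie in $\mathfrak A(\mathcal H,\mathcal K)$; $\mathfrak A(\mathcal H,\mathcal K)$ is closed under addition; $CAB\in\mathfrak A(\mathcal H_1,\mathcal K_1)$ for $A\in\mathfrak A(\mathcal H,\mathcal K)$, $B\in\mathcal B(\mathcal H_1,\mathcal H)$, $C\in\mathcal B(\mathcal K,\mathcal K_1)$. $\mathfrak A^*(\mathcal K,\mathcal H)=\{A^*:A\in\mathfrak A(\mathcal H,\mathcal K)\}$; $(\mathfrak A\cdot\mathfrak B)(\mathcal H,\mathcal K)$ is the set of products $AB$ with $A\in\mathfrak A(\mathcal G',\mathcal K)$, $B\in\mathfrak B(\mathcal H,\mathcal G')$ for some Hilbert space $\mathcal G'$; $\mathfrak A(\mathcal H)=\mathfrak A(\mathcal H,\mathcal H)$, and similarly for products. *)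

theory Defs
  imports "HOL-Analysis.Analysis"
begin

section \<open>Complex inner product spaces\<close>

text \<open>
  The inner product is linear in the first argument. Topology and norm are those of the underlying
  \<^class>\<open>real_inner\<close>, whose inner product is the real part of the complex one.
\<close>

class complex_inner = real_inner +
  fixes scaleC :: "complex \<Rightarrow> 'a \<Rightarrow> 'a" (infixr "*\<^sub>C" 75)
    and cinner :: "'a \<Rightarrow> 'a \<Rightarrow> complex"
  assumes scaleC_add_right: "c *\<^sub>C (x + y) = c *\<^sub>C x + c *\<^sub>C y"
    and scaleC_add_left: "(c + d) *\<^sub>C x = c *\<^sub>C x + d *\<^sub>C x"
    and scaleC_scaleC: "c *\<^sub>C d *\<^sub>C x = (c * d) *\<^sub>C x"
    and scaleC_one: "1 *\<^sub>C x = x"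
    and scaleR_scaleC: "r *\<^sub>R x = complex_of_real r *\<^sub>C x"
    and cinner_add_left: "cinner (x + y) z = cinner x z + cinner y z"
    and cinner_scaleC_left: "cinner (c *\<^sub>C x) y = c * cinner x y"
    and cinner_commute: "cinner y x = cnj (cinner x y)"
    and inner_eq_Re_cinner: "inner x y = Re (cinner x y)"

instantiation complex :: complex_inner
begin

definition scaleC_complex :: "complex \<Rightarrow> complex \<Rightarrow> complex"
  where "scaleC_complex c x = c * x"

definition cinner_complex :: "complex \<Rightarrow> complex \<Rightarrow> complex"
  where "cinner_complex x y = x * cnj y"

instance
  by standard
    (auto simp: scaleC_complex_def cinner_complex_def inner_complex_def scaleR_conv_of_real
      algebra_simps)

end

instantiation prod :: (complex_inner, complex_inner) complex_inner
begin

definition scaleC_prod :: "complex \<Rightarrow> 'a \<times> 'b \<Rightarrow> 'a \<times> 'b"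
  where "scaleC_prod c x = (c *\<^sub>C fst x, c *\<^sub>C snd x)"

definition cinner_prod :: "'a \<times> 'b \<Rightarrow> 'a \<times> 'b \<Rightarrow> complex"
  where "cinner_prod x y = cinner (fst x) (fst y) + cinner (snd x) (snd y)"

instance
proof
  fix x y :: "'a \<times> 'b"
  show "cinner y x = cnj (cinner x y)"
    using cinner_commute[of "fst x" "fst y"] cinner_commute[of "snd x" "snd y"]
    by (simp add: cinner_prod_def)
qed (auto simp: scaleC_prod_def cinner_prod_def inner_prod_def prod_eq_iff scaleC_add_right
  scaleC_add_left scaleC_scaleC scaleC_one scaleR_scaleC cinner_add_left cinner_scaleC_left
  inner_eq_Re_cinner algebra_simps)

end

global_interpretation complex_vector: vector_space "scaleC :: complex \<Rightarrow> 'a \<Rightarrow> 'a::complex_inner"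
  defines csubspace = complex_vector.subspace
    and cspan = complex_vector.span
  by unfold_locales
    (auto simp: scaleC_add_right scaleC_add_left scaleC_scaleC scaleC_one)

text \<open>
  A class of operator ideals is indexed by all pairs of Hilbert spaces, and one cannot quantify over
  types inside a proposition. Hilbert spaces are therefore complete linear subspaces of an arbitrary
  complex inner product space type \<^typ>\<open>'a\<close>, with the inherited structure. A Hilbert space given as
  a type is the case \<^const>\<open>UNIV\<close>, and any set of Hilbert spaces is found, up to unitary equivalence,
  among the closed subspaces of its direct sum.
\<close>

definition hilbert_space :: "'a::complex_inner set \<Rightarrow> bool"
  where "hilbert_space H \<longleftrightarrow> csubspace H \<and> complete H"

definition separable_hilbert_space :: "'a::complex_inner set \<Rightarrow> bool"
  where "separable_hilbert_space H \<longleftrightarrow> hilbert_space H \<and> separable_space (top_of_set H)"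


section \<open>Linear relations\<close>

text \<open>
  Linear relations, and in particular all operators, are identified with their graphs. Domain, range
  and inverse of a relation are \<^const>\<open>Domain\<close>, \<^const>\<open>Range\<close> and \<^const>\<open>converse\<close>; the operator
  product $AB$ (first $B$, then $A$) is \<^term>\<open>B O A\<close>. A Hilbert space in \<^typ>\<open>'a\<close> is closed in all
  larger ones, so closedness of a relation does not depend on the spaces in which it is considered.
\<close>

definition linear_relation :: "'a::complex_inner set \<Rightarrow> 'a set \<Rightarrow> ('a \<times> 'a) set \<Rightarrow> bool"
  where "linear_relation H K S \<longleftrightarrow> csubspace S \<and> S \<subseteq> H \<times> K"

definition ker_rel :: "('a::complex_inner \<times> 'a) set \<Rightarrow> 'a set"
  where "ker_rel S = {f. (f, 0) \<in> S}"

definition shift_rel :: "('a::complex_inner \<times> 'a) set \<Rightarrow> complex \<Rightarrow> ('a \<times> 'a) set"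
  where "shift_rel S l = {(f, f' - l *\<^sub>C f) | f f'. (f, f') \<in> S}"

text \<open>The adjoint of a relation from \<^term>\<open>H\<close> to \<^term>\<open>K\<close>, a relation from \<^term>\<open>K\<close> to \<^term>\<open>H\<close>.\<close>

definition adjoint_rel :: "'a::complex_inner set \<Rightarrow> 'a set \<Rightarrow> ('a \<times> 'a) set \<Rightarrow> ('a \<times> 'a) set"
  where "adjoint_rel H K S =
    {(g, g'). g \<in> K \<and> g' \<in> H \<and> (\<forall>(f, f') \<in> S. cinner f' g = cinner f g')}"

definition closed_symmetric_relation :: "'a::complex_inner set \<Rightarrow> ('a \<times> 'a) set \<Rightarrow> bool"
  where "closed_symmetric_relation H S \<longleftrightarrow>
    linear_relation H H S \<and> closed S \<and> S \<subseteq> adjoint_rel H H S"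

definition selfadjoint_relation :: "'a::complex_inner set \<Rightarrow> ('a \<times> 'a) set \<Rightarrow> bool"
  where "selfadjoint_relation H S \<longleftrightarrow> linear_relation H H S \<and> S = adjoint_rel H H S"


section \<open>Bounded and compact operators, resolvent set, essential spectrum\<close>

definition bounded_ops :: "'a::complex_inner set \<Rightarrow> 'a set \<Rightarrow> ('a \<times> 'a) set set"
  where "bounded_ops H K =
    {B. linear_relation H K B \<and> single_valued B \<and> Domain B = H \<and>
        (\<exists>c. \<forall>(f, g) \<in> B. norm g \<le> c * norm f)}"

definition compact_ops :: "'a::complex_inner set \<Rightarrow> 'a set \<Rightarrow> ('a \<times> 'a) set set"
  where "compact_ops H K = {B \<in> bounded_ops H K. compact (closure (B `` {f \<in> H. norm f \<le> 1}))}"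

definition resolvent_set :: "'a::complex_inner set \<Rightarrow> ('a \<times> 'a) set \<Rightarrow> complex set"
  where "resolvent_set H S = {l. (shift_rel S l)\<inverse> \<in> bounded_ops H H}"

definition fredholm :: "'a::complex_inner set \<Rightarrow> ('a \<times> 'a) set \<Rightarrow> bool"
  where "fredholm K R \<longleftrightarrow>
    (\<exists>B. finite B \<and> ker_rel R = cspan B) \<and>
    closed (Range R) \<and>
    (\<exists>B. finite B \<and> K = cspan (Range R \<union> B))"

definition op_part :: "('a::complex_inner \<times> 'a) set \<Rightarrow> ('a \<times> 'a) set"
  where "op_part S = S \<inter> closure (Domain S) \<times> closure (Domain S)"

text \<open>
  For a self-adjoint relation \<^term>\<open>S\<close>, Fredholmness refers to the operator \<^term>\<open>op_part S\<close> in the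
  Hilbert space \<^term>\<open>closure (Domain S)\<close>, the orthogonal complement of the multivalued part.
\<close>

definition essential_spectrum :: "('a::complex_inner \<times> 'a) set \<Rightarrow> complex set"
  where "essential_spectrum S = {l. \<not> fredholm (closure (Domain S)) (shift_rel (op_part S) l)}"


section \<open>Quasi boundary triples\<close>

definition clinear_on :: "'a::complex_inner set \<Rightarrow> ('a \<Rightarrow> 'b::complex_inner) \<Rightarrow> bool"
  where "clinear_on T F \<longleftrightarrow>
    (\<forall>x\<in>T. \<forall>y\<in>T. F (x + y) = F x + F y) \<and> (\<forall>c. \<forall>x\<in>T. F (c *\<^sub>C x) = c *\<^sub>C F x)"

definition ker_on :: "'a::complex_inner set \<Rightarrow> ('a \<Rightarrow> 'b::complex_inner) \<Rightarrow> 'a set"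
  where "ker_on T F = {x \<in> T. F x = 0}"

definition quasi_boundary_triple ::
  "'a::complex_inner set \<Rightarrow> ('a \<times> 'a) set \<Rightarrow> 'a set \<Rightarrow> ('a \<times> 'a) set \<Rightarrow>
    ('a \<times> 'a \<Rightarrow> 'a) \<Rightarrow> ('a \<times> 'a \<Rightarrow> 'a) \<Rightarrow> bool"
  where "quasi_boundary_triple H A G T \<Gamma>0 \<Gamma>1 \<longleftrightarrow>
    hilbert_space G \<and>
    csubspace T \<and> T \<subseteq> adjoint_rel H H A \<and> adjoint_rel H H A \<subseteq> closure T \<and>
    \<Gamma>0 ` T \<subseteq> G \<and> \<Gamma>1 ` T \<subseteq> G \<and> clinear_on T \<Gamma>0 \<and> clinear_on T \<Gamma>1 \<and>
    G \<times> G \<subseteq> closure ((\<lambda>x. (\<Gamma>0 x, \<Gamma>1 x)) ` T) \<and>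
    selfadjoint_relation H (ker_on T \<Gamma>0) \<and>
    (\<forall>(f, f') \<in> T. \<forall>(g, g') \<in> T.
      cinner f' g - cinner f g' =
        cinner (\<Gamma>1 (f, f')) (\<Gamma>0 (g, g')) - cinner (\<Gamma>0 (f, f')) (\<Gamma>1 (g, g')))"

definition extension_rel ::
  "('a::complex_inner \<times> 'a) set \<Rightarrow> ('a \<times> 'a \<Rightarrow> 'a) \<Rightarrow> ('a \<times> 'a \<Rightarrow> 'a) \<Rightarrow> ('a \<times> 'a) set \<Rightarrow> ('a \<times> 'a) set"
  where "extension_rel T \<Gamma>0 \<Gamma>1 \<Theta> = {x \<in> T. (\<Gamma>0 x, \<Gamma>1 x) \<in> \<Theta>}"

definition defect_rel :: "('a::complex_inner \<times> 'a) set \<Rightarrow> complex \<Rightarrow> ('a \<times> 'a) set"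
  where "defect_rel T l = {(f, l *\<^sub>C f) | f. f \<in> ker_rel (shift_rel T l)}"

text \<open>
  The graphs of $\pi_1 (\Gamma_0 \upharpoonright \hat N_{l,T})^{-1}$ and
  $\Gamma_1 (\Gamma_0 \upharpoonright \hat N_{l,T})^{-1}$; they are graphs of operators with domain
  $\mathrm{ran}\,\Gamma_0$ for \<^term>\<open>l\<close> in the resolvent set of $\ker \Gamma_0$.
\<close>

definition gamma_field ::
  "('a::complex_inner \<times> 'a) set \<Rightarrow> ('a \<times> 'a \<Rightarrow> 'a) \<Rightarrow> complex \<Rightarrow> ('a \<times> 'a) set"
  where "gamma_field T \<Gamma>0 l = {(\<Gamma>0 x, fst x) | x. x \<in> defect_rel T l}"

definition weyl_function ::
  "('a::complex_inner \<times> 'a) set \<Rightarrow> ('a \<times> 'a \<Rightarrow> 'a) \<Rightarrow> ('a \<times> 'a \<Rightarrow> 'a) \<Rightarrow> complex \<Rightarrow> ('a \<times> 'a) set"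
  where "weyl_function T \<Gamma>0 \<Gamma>1 l = {(\<Gamma>0 x, \<Gamma>1 x) | x. x \<in> defect_rel T l}"


section \<open>Classes of operator ideals\<close>

definition add_op :: "('a::complex_inner \<times> 'a) set \<Rightarrow> ('a \<times> 'a) set \<Rightarrow> ('a \<times> 'a) set"
  where "add_op A B = {(f, g + h) | f g h. (f, g) \<in> A \<and> (f, h) \<in> B}"

definition diff_op :: "('a::complex_inner \<times> 'a) set \<Rightarrow> ('a \<times> 'a) set \<Rightarrow> ('a \<times> 'a) set"
  where "diff_op A B = {(f, g - h) | f g h. (f, g) \<in> A \<and> (f, h) \<in> B}"

definition rank_one :: "'a::complex_inner set \<Rightarrow> 'a \<Rightarrow> 'a \<Rightarrow> ('a \<times> 'a) set"
  where "rank_one H u v = {(x, cinner x u *\<^sub>C v) | x. x \<in> H}"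

type_synonym 'a op_class = "'a set \<Rightarrow> 'a set \<Rightarrow> ('a \<times> 'a) set set"

definition operator_ideal_class :: "'a::complex_inner op_class \<Rightarrow> bool"
  where "operator_ideal_class \<AA> \<longleftrightarrow>
    (\<forall>H K. separable_hilbert_space H \<longrightarrow> separable_hilbert_space K \<longrightarrow>
      \<AA> H K \<subseteq> compact_ops H K \<and>
      (\<forall>u\<in>H. \<forall>v\<in>K. rank_one H u v \<in> \<AA> H K) \<and>
      (\<forall>A \<in> \<AA> H K. \<forall>B \<in> \<AA> H K. add_op A B \<in> \<AA> H K) \<and>
      (\<forall>H1 K1. separable_hilbert_space H1 \<longrightarrow> separable_hilbert_space K1 \<longrightarrow>
        (\<forall>A \<in> \<AA> H K. \<forall>B \<in> bounded_ops H1 H. \<forall>C \<in> bounded_ops K K1.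
          B O A O C \<in> \<AA> H1 K1)))"

definition adjoint_class :: "'a::complex_inner op_class \<Rightarrow> 'a op_class"
  where "adjoint_class \<AA> K H = {adjoint_rel H K A | A. A \<in> \<AA> H K}"

definition product_class ::
  "'a::complex_inner op_class \<Rightarrow> 'a op_class \<Rightarrow> 'a op_class"
  where "product_class \<AA> \<BB> H K =
    {B O A | A B. \<exists>G. separable_hilbert_space G \<and> A \<in> \<AA> G K \<and> B \<in> \<BB> H G}"

end

theory Submission
  imports Defs
begin

text \<open>
  Fix a non-real $\mu$ at which $K = \overline{M(\mu)}$ is compact. Green's identity and the density of
  the range of the boundary map show that the imaginary part of $(K \varphi, \varphi)$ vanishes only
  for $\varphi = 0$. Since $0$ is not in the essential spectrum of $\Theta$, a bounded sequence in the
  domain of $\Theta$ with convergent images has a convergent subsequence. By compactness of $K$ and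
  definiteness of its imaginary part, $\Theta - K$ is bounded below and, since the same definiteness
  applies to the adjoint, has dense range; hence $B = (\Theta - K)^{-1}$ is bounded and everywhere
  defined.

  For arbitrary $l$, real or not, in both resolvent sets, the resolvent difference is
  $(I + (l - \mu)(A_\Theta - l)^{-1})\, \overline{\gamma(\mu)}\, B\, \gamma(\bar l)^*$. The factors
  $\overline{\gamma(\mu)}$ and $\gamma(\bar l)^*$ lie in the ideal and in its adjoint, because
  $\gamma(\nu) = (I + (\nu - l_1)(A_0 - \nu)^{-1})\gamma(l_1)$.
\<close>

section \<open>Complex inner product spaces\<close>

text \<open>The boundary operators \<open>gamma_field\<close> and \<open>weyl_function\<close> live
  only on the dense range of \<open>\<Gamma>0\<close>, so the composition formulas are first proved
  as inclusions of graphs. Such an inclusion becomes an equality as soon as the smaller graph is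
  defined everywhere and the larger one is single-valued; the closure of
  \<open>\<gamma> \<nu>\<close> is never computed, a bounded extension taken from the ideal does its
  work. Two spectral parameters occur because M is assumed compact at one nonreal point only and
  definiteness comes from the imaginary part of that point, whereas the parameter of the resolvent
  difference may be real; a resolvent of the self-adjoint extension bridges the two. The rules of an
  ideal class concern separable spaces, while \<open>quasi_boundary_triple\<close> asks only for a
  Hilbert space. Separability of the boundary space is therefore extracted from the compact
  operator: definiteness makes its range dense.\<close>

lemma cinner_add_right: "cinner x (y + z) = cinner x y + cinner x (z::'a::complex_inner)"
  by (metis cinner_add_left cinner_commute complex_cnj_add)

lemma cinner_scaleC_right: "cinner x (c *\<^sub>C y) = cnj c * cinner x (y::'a::complex_inner)"
  by (metis cinner_commute cinner_scaleC_left complex_cnj_mult)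

lemma cinner_self: "cinner x x = complex_of_real ((norm (x::'a::complex_inner))\<^sup>2)"
proof -
  have "Im (cinner x x) = 0"
    using cinner_commute[of x x] by (simp add: complex_eq_iff)
  moreover have "Re (cinner x x) = (norm x)\<^sup>2"
    by (simp add: power2_norm_eq_inner inner_eq_Re_cinner)
  ultimately show ?thesis
    by (simp add: complex_eq_iff)
qed

lemma norm_scaleC: "norm (c *\<^sub>C x) = norm c * norm (x::'a::complex_inner)"
proof -
  have "complex_of_real ((norm (c *\<^sub>C x))\<^sup>2) = complex_of_real ((norm c * norm x)\<^sup>2)"
  proof -
    have "complex_of_real ((norm (c *\<^sub>C x))\<^sup>2) = (c * cnj c) * cinner x x"
      using cinner_self[of "c *\<^sub>C x"]
      by (simp only: cinner_scaleC_left cinner_scaleC_right mult_ac)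
    then show ?thesis
      by (simp only: cinner_self complex_norm_square[symmetric] power_mult_distrib of_real_mult)
  qed
  then have "(norm (c *\<^sub>C x))\<^sup>2 = (norm c * norm x)\<^sup>2"
    using of_real_eq_iff by blast
  then show ?thesis
    by (rule power2_eq_imp_eq) simp_all
qed

lemma norm_cinner_le: "norm (cinner x y) \<le> norm x * norm (y::'a::complex_inner)"
proof (cases "cinner x y = 0")
  case False
  \<comment> \<open>Multiplying \<open>x\<close> by this factor of modulus one turns the inner
    product into its modulus, so the real Cauchy-Schwarz inequality applies.\<close>
  define c where "c = cnj (sgn (cinner x y))"
  have "complex_of_real (norm (cinner x y)) = c * cinner x y"
    using False
    by (simp add: c_def sgn_div_norm scaleR_conv_of_real divide_inverse complex_norm_square[symmetric]
        mult.assoc power2_eq_square flip: of_real_mult) 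
      (simp add: complex_norm_square[symmetric] power2_eq_square mult.commute[of "cnj _"])
  then have "norm (cinner x y) = Re (cinner (c *\<^sub>C x) y)"
    by (metis Re_complex_of_real cinner_scaleC_left)
  also have "\<dots> \<le> norm (c *\<^sub>C x) * norm y"
    unfolding inner_eq_Re_cinner[symmetric] by (rule norm_cauchy_schwarz)
  also have "norm (c *\<^sub>C x) = norm x"
    using False by (simp add: norm_scaleC c_def norm_sgn)
  finally show ?thesis .
qed simp

lemma bounded_bilinear_cinner: "bounded_bilinear (cinner :: 'a::complex_inner \<Rightarrow> 'a \<Rightarrow> complex)"
proof
  show "\<exists>K. \<forall>x y :: 'a. norm (cinner x y) \<le> norm x * norm y * K"
    using norm_cinner_le by (metis mult.right_neutral)
qed (simp_all add: cinner_add_left cinner_add_right scaleR_scaleC cinner_scaleC_left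
    cinner_scaleC_right scaleC_complex_def)

lemma bounded_bilinear_scaleC: "bounded_bilinear (scaleC :: complex \<Rightarrow> 'a::complex_inner \<Rightarrow> 'a)"
proof
  show "\<exists>K. \<forall>c (x :: 'a). norm (c *\<^sub>C x) \<le> norm c * norm x * K"
    by (intro exI[of _ 1]) (simp add: norm_scaleC)
qed (simp_all add: scaleC_add_left scaleC_add_right scaleR_scaleC scaleC_scaleC
    scaleC_complex_def mult.commute)

lemmas cinner_diff_left = bounded_bilinear.diff_left[OF bounded_bilinear_cinner]
lemmas cinner_diff_right = bounded_bilinear.diff_right[OF bounded_bilinear_cinner]
lemmas cinner_zero_left [simp] = bounded_bilinear.zero_left[OF bounded_bilinear_cinner]
lemmas cinner_zero_right [simp] = bounded_bilinear.zero_right[OF bounded_bilinear_cinner]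
lemmas tendsto_cinner = bounded_bilinear.tendsto[OF bounded_bilinear_cinner]
lemmas tendsto_scaleC = bounded_bilinear.tendsto[OF bounded_bilinear_scaleC]

lemmas csubspace_0 = complex_vector.subspace_0
lemmas csubspace_add = complex_vector.subspace_add
lemmas csubspace_diff = complex_vector.subspace_diff
lemmas csubspace_scaleC = complex_vector.subspace_scale

lemmas scaleC_diff_right = complex_vector.scale_right_diff_distrib
lemmas scaleC_diff_left = complex_vector.scale_left_diff_distrib

lemma cinner_eq_0_commute: "cinner x y = 0 \<longleftrightarrow> cinner y (x::'a::complex_inner) = 0"
  by (metis cinner_commute complex_cnj_zero_iff)

lemma cinner_self_eq_0: "cinner x x = 0 \<longleftrightarrow> x = (0::'a::complex_inner)"
  by (simp add: cinner_self)

section \<open>Closed subspaces, orthogonal projections and Riesz representation\<close>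

lemma csubspace_closure:
  fixes V :: "'a::complex_inner set"
  assumes "csubspace V"
  shows "csubspace (closure V)"
  unfolding complex_vector.subspace_def
proof (intro conjI ballI allI)
  show "0 \<in> closure V"
    using assms csubspace_0 closure_subset by blast
next
  fix x y assume "x \<in> closure V" "y \<in> closure V"
  then obtain f g where "\<And>n. f n \<in> V" "f \<longlonglongrightarrow> x" "\<And>n. g n \<in> V" "g \<longlonglongrightarrow> y"
    unfolding closure_sequential by blast
  then have "(\<lambda>n. f n + g n) \<longlonglongrightarrow> x + y" "\<And>n. f n + g n \<in> V"
    using csubspace_add[OF assms] by (auto intro: tendsto_add)
  then show "x + y \<in> closure V"
    unfolding closure_sequential by (intro exI[of _ "\<lambda>n. f n + g n"]) simp
next
  fix c x assume "x \<in> closure V"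
  then obtain f where "\<And>n. f n \<in> V" "f \<longlonglongrightarrow> x"
    unfolding closure_sequential by blast
  then have "(\<lambda>n. c *\<^sub>C f n) \<longlonglongrightarrow> c *\<^sub>C x" "\<And>n. c *\<^sub>C f n \<in> V"
    using csubspace_scaleC[OF assms] by (auto intro: tendsto_scaleC)
  then show "c *\<^sub>C x \<in> closure V"
    unfolding closure_sequential by (intro exI[of _ "\<lambda>n. c *\<^sub>C f n"]) simp
qed

lemma csubspace_imp_subspace: "csubspace V \<Longrightarrow> subspace V"
  unfolding complex_vector.subspace_def subspace_def by (simp add: scaleR_scaleC)

text \<open>A minimizing sequence for the distance to \<open>V\<close> is Cauchy by the
  parallelogram law. Completeness is asked of \<open>V\<close> itself because the ambient type need
  not be complete.\<close>

lemma orthogonal_projection_exists: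
  fixes V :: "'a::complex_inner set"
  assumes V: "csubspace V" and "complete V"
  obtains y where "y \<in> V" "\<And>z. z \<in> V \<Longrightarrow> cinner (x - y) z = 0"
proof -
  define d where "d = (INF z\<in>V. (norm (x - z))\<^sup>2)"
  have V0: "0 \<in> V"
    using V by (rule csubspace_0)
  have d_le: "d \<le> (norm (x - z))\<^sup>2" if "z \<in> V" for z
    unfolding d_def by (rule cINF_lower) (use that in \<open>auto intro!: bdd_belowI[of _ 0]\<close>)
  have "\<exists>z\<in>V. (norm (x - z))\<^sup>2 < d + 1 / Suc n" for n
  proof (rule ccontr)
    assume "\<not> ?thesis"
    then have "d + 1 / Suc n \<le> d"
      unfolding d_def using V0 by (intro cINF_greatest) (force simp: d_def not_less)+
    then show False
      by (simp add: field_simps)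
  qed
  then obtain f where f: "\<And>n. f n \<in> V" "\<And>n. (norm (x - f n))\<^sup>2 < d + 1 / Suc n"
    by metis
  have dist_f: "(norm (f m - f n))\<^sup>2 \<le> 2 / Suc m + 2 / Suc n" for m n
  proof -
    have "(1/2) *\<^sub>R (f m + f n) \<in> V"
      using f(1) csubspace_imp_subspace[OF V] by (intro subspace_scale subspace_add)
    from d_le[OF this] have "4 * d \<le> (2 * norm (x - (1/2) *\<^sub>R (f m + f n)))\<^sup>2"
      by (simp add: power_mult_distrib)
    also have "2 * norm (x - (1/2) *\<^sub>R (f m + f n)) = norm ((x - f m) + (x - f n))"
    proof -
      have "(x - f m) + (x - f n) = 2 *\<^sub>R (x - (1/2) *\<^sub>R (f m + f n))"
        by (simp add: algebra_simps scaleR_2)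
      then show ?thesis by simp
    qed
    finally have "4 * d \<le> (norm ((x - f m) + (x - f n)))\<^sup>2" .
    moreover have "(norm (f m - f n))\<^sup>2 + (norm ((x - f m) + (x - f n)))\<^sup>2 =
        2 * (norm (x - f m))\<^sup>2 + 2 * (norm (x - f n))\<^sup>2"
      by (simp add: power2_norm_eq_inner inner_simps inner_commute algebra_simps)
    ultimately show ?thesis
      using f(2)[of m] f(2)[of n] by simp
  qed
  have "Cauchy f"
  proof (rule metric_CauchyI)
    fix e :: real assume e: "0 < e"
    obtain N where N: "4 / e\<^sup>2 < Suc N"
      using reals_Archimedean2 by (meson less_SucI of_nat_less_iff less_trans lessI)
    then have N': "4 / Suc N < e\<^sup>2"
      using e by (simp add: field_simps)
    have "dist (f m) (f n) < e" if "N \<le> m" "N \<le> n" for m n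
    proof -
      have "2 / Suc m + 2 / Suc n \<le> 2 / Suc N + 2 / Suc N"
        using that by (intro add_mono divide_left_mono) auto
      then have "(norm (f m - f n))\<^sup>2 < e\<^sup>2"
        using dist_f[of m n] N' by simp
      then show ?thesis
        using e by (simp add: dist_norm power2_less_imp_less)
    qed
    then show "\<exists>N. \<forall>m\<ge>N. \<forall>n\<ge>N. dist (f m) (f n) < e"
      by blast
  qed
  then obtain y where y: "y \<in> V" "f \<longlonglongrightarrow> y"
    using \<open>complete V\<close> f(1) unfolding complete_def by blast
  have "(\<lambda>n. (norm (x - f n))\<^sup>2) \<longlonglongrightarrow> (norm (x - y))\<^sup>2"
    by (intro tendsto_intros y)
  moreover have "(\<lambda>n. d + 1 / Suc n) \<longlonglongrightarrow> d + 0"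
    by (intro tendsto_add tendsto_const LIMSEQ_Suc[OF lim_1_over_n])
  moreover have "\<exists>N. \<forall>n\<ge>N. (norm (x - f n))\<^sup>2 \<le> d + 1 / Suc n"
    using f(2) less_imp_le by blast
  ultimately have y_le: "(norm (x - y))\<^sup>2 \<le> d"
    using LIMSEQ_le by fastforce
  have orth: "inner (x - y) z = 0" if z: "z \<in> V" for z
  proof (cases "z = 0")
    case False
    \<comment> \<open>The point \<open>t *\<^sub>R z\<close> is the best approximation of
      \<open>x - y\<close> on the real line through \<open>z\<close>; if \<open>t\<close> were
      nonzero, moving \<open>y\<close> by it would beat the minimal distance.\<close>
    define t where "t = inner (x - y) z / inner z z"
    have "y + t *\<^sub>R z \<in> V"
      using y(1) z csubspace_imp_subspace[OF V] by (intro subspace_scale subspace_add)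
    from d_le[OF this] y_le have "(norm (x - y))\<^sup>2 \<le> (norm ((x - y) - t *\<^sub>R z))\<^sup>2"
      by (metis diff_diff_add order_trans)
    also have "\<dots> = (norm (x - y))\<^sup>2 - 2 * t * inner (x - y) z + t * t * inner z z"
      by (simp add: power2_norm_eq_inner inner_diff_left inner_diff_right inner_commute algebra_simps)
    also have "\<dots> = (norm (x - y))\<^sup>2 - (inner (x - y) z)\<^sup>2 / inner z z"
      using False by (simp add: t_def power2_eq_square field_simps)
    finally have "(inner (x - y) z)\<^sup>2 / inner z z \<le> 0"
      by simp
    then show ?thesis
      using False inner_gt_zero_iff[of z] by (auto simp del: inner_gt_zero_iff simp: divide_le_0_iff)
  qed simp
  \<comment> \<open>Real orthogonality to \<open>z\<close> kills the real part, real orthogonality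
    to \<open>i z\<close> the imaginary part.\<close>
  have "cinner (x - y) z = 0" if z: "z \<in> V" for z
  proof -
    have "\<i> *\<^sub>C z \<in> V"
      using V z by (rule csubspace_scaleC)
    from orth[OF z] orth[OF this] show ?thesis
      by (simp add: inner_eq_Re_cinner cinner_scaleC_right complex_eq_iff)
  qed
  then show thesis
    using that y(1) by blast
qed

text \<open>The difference between a vector of \<open>G\<close> and its projection onto the closure
  of \<open>V\<close> is orthogonal to \<open>V\<close>. This is the tool by which ranges are shown
  to be dense.\<close>

lemma orthogonal_complement_trivial_imp_closure_eq:
  fixes G :: "'a::complex_inner set"
  assumes G: "complete G" and V: "csubspace V" "V \<subseteq> G" and "csubspace G"
    and trivial: "\<And>y. y \<in> G \<Longrightarrow> (\<And>z. z \<in> V \<Longrightarrow> cinner y z = 0) \<Longrightarrow> y = 0"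
  shows "closure V = G"
proof
  show sub: "closure V \<subseteq> G"
    using V(2) complete_imp_closed[OF G] by (rule closure_minimal)
  have cV: "complete (closure V)"
    using complete_closed_subset[OF closed_closure sub G] .
  show "G \<subseteq> closure V"
  proof
    fix x assume x: "x \<in> G"
    obtain y where y: "y \<in> closure V" "\<And>z. z \<in> closure V \<Longrightarrow> cinner (x - y) z = 0"
      using orthogonal_projection_exists[OF csubspace_closure[OF V(1)] cV] by blast
    have "x - y \<in> G"
      using x y(1) sub csubspace_diff[OF \<open>csubspace G\<close>] by blast
    then have "x - y = 0"
      using trivial y(2) closure_subset by blast
    then show "x \<in> closure V"
      using y(1) by simp
  qed
qed

text \<open>Boundedness makes the kernel \<open>N\<close> complete, so a vector outside
  \<open>N\<close> has a nonzero part \<open>w\<close> orthogonal to \<open>N\<close>. The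
  combination of \<open>x\<close> and \<open>w\<close> that lies in \<open>N\<close> is orthogonal
  to \<open>w\<close>, which expresses \<open>F x\<close> through \<open>cinner x w\<close>.\<close>

lemma riesz_representation:
  fixes V :: "'a::complex_inner set"
  assumes V: "csubspace V" "complete V" and F: "clinear_on V F"
    and bound: "\<And>x. x \<in> V \<Longrightarrow> norm (F x) \<le> c * norm x"
  obtains z where "z \<in> V" "\<And>x. x \<in> V \<Longrightarrow> F x = cinner x z"
proof -
  have add: "F (x + y) = F x + F y" if "x \<in> V" "y \<in> V" for x y
    using F that by (auto simp: clinear_on_def)
  have scale: "F (a *\<^sub>C x) = a * F x" if "x \<in> V" for a x
    using F that by (auto simp: clinear_on_def scaleC_complex_def)
  have diff: "F (x - y) = F x - F y" if "x \<in> V" "y \<in> V" for x y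
    using add[of "x - y" y] that V(1) csubspace_diff by fastforce
  define N where "N = {x \<in> V. F x = 0}"
  have N: "csubspace N"
    using V(1) unfolding N_def complex_vector.subspace_def
    by (auto simp: add scale) (metis V(1) add csubspace_0 add_cancel_right_right)
  have "complete N"
  proof (rule completeI)
    fix f assume f: "\<forall>n. f n \<in> N" and "Cauchy f"
    then obtain x where x: "x \<in> V" "f \<longlonglongrightarrow> x"
      using V(2) unfolding complete_def N_def by blast
    have "norm (F x) \<le> c * norm (x - f n)" for n
      using bound[of "x - f n"] diff[of x "f n"] f x csubspace_diff[OF V(1)] by (auto simp: N_def)
    moreover have "(\<lambda>n. c * norm (x - f n)) \<longlonglongrightarrow> c * norm (x - x)"
      by (intro tendsto_intros x)
    ultimately have "norm (F x) \<le> c * norm (x - x)"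
      by (intro LIMSEQ_le_const) auto
    then show "\<exists>l\<in>N. f \<longlonglongrightarrow> l"
      using x by (intro bexI[of _ x]) (auto simp: N_def)
  qed
  show thesis
  proof (cases "V \<subseteq> N")
    case True
    then show ?thesis
      using that[of 0] csubspace_0[OF V(1)] by (auto simp: N_def)
  next
    case False
    then obtain v where v: "v \<in> V" "v \<notin> N" by blast
    obtain y where y: "y \<in> N" "\<And>z. z \<in> N \<Longrightarrow> cinner (v - y) z = 0"
      using orthogonal_projection_exists[OF N \<open>complete N\<close>] by blast
    define w where "w = v - y"
    have w: "w \<in> V" "F w \<noteq> 0"
      using v y(1) diff[of v y] csubspace_diff[OF V(1)] by (auto simp: w_def N_def)
    have "w \<noteq> 0"
      using w(2) N csubspace_0 by (force simp: N_def)
    \<comment> \<open>The scaling is fixed by \<open>cinner w z = F w\<close>; the conjugate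
      compensates conjugate linearity in the second argument.\<close>
    define z where "z = cnj (F w / cinner w w) *\<^sub>C w"
    have "F x = cinner x z" if x: "x \<in> V" for x
    proof -
      have "F w *\<^sub>C x - F x *\<^sub>C w \<in> N"
        using x w V(1) by (auto simp: N_def diff scale csubspace_diff csubspace_scaleC)
      then have "cinner (F w *\<^sub>C x - F x *\<^sub>C w) w = 0"
        using y(2) cinner_eq_0_commute by (metis w_def)
      then have "F w * cinner x w = F x * cinner w w"
        by (simp add: cinner_diff_left cinner_scaleC_left)
      moreover have "cinner x z = F w * cinner x w / cinner w w"
        by (simp only: z_def cinner_scaleC_right complex_cnj_cnj times_divide_eq_left)
      moreover have "cinner w w \<noteq> 0"
        using \<open>w \<noteq> 0\<close> cinner_self_eq_0 by blast
      ultimately show ?thesis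
        by (metis nonzero_mult_div_cancel_right)
    qed
    then show ?thesis
      using that[of z] csubspace_scaleC[OF V(1) w(1)] unfolding z_def by blast
  qed
qed

section \<open>Baire category, uniform boundedness and compactness in finite dimensions\<close>

lemma completely_metrizable_space_complete:
  fixes V :: "'a::metric_space set"
  assumes "complete V"
  shows "completely_metrizable_space (top_of_set V)"
proof -
  interpret S: Submetric UNIV dist V
    by unfold_locales auto
  have "S.sub.mcomplete"
    unfolding S.sub.mcomplete_def
  proof (intro allI impI)
    fix f assume f: "S.sub.MCauchy f"
    then have "Cauchy f" "\<And>n. f n \<in> V"
      by (auto simp: S.sub.MCauchy_def Cauchy_def)
    then obtain l where "l \<in> V" "f \<longlonglongrightarrow> l"
      using assms unfolding complete_def by blast
    then show "\<exists>x. limitin S.sub.mtopology f x sequentially"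
      using \<open>\<And>n. f n \<in> V\<close> by (auto simp: S.mtopology_submetric limitin_subtopology)
  qed
  then show ?thesis
    using S.sub.completely_metrizable_space_mtopology by (simp add: S.mtopology_submetric)
qed

text \<open>Elements of \<open>Q\<close> act as functionals on \<open>V\<close> by the inner
  product. By Baire's theorem one of the closed sets \<open>F n\<close> contains a relative ball of
  \<open>V\<close>, and differences of points of this ball carry the bound to the origin.\<close>

lemma uniform_boundedness:
  fixes V :: "'a::complex_inner set"
  assumes V: "csubspace V" "complete V" and "Q \<subseteq> V"
    and pointwise: "\<And>z. z \<in> V \<Longrightarrow> \<exists>b. \<forall>q\<in>Q. norm (cinner z q) \<le> b"
  obtains b where "\<And>q. q \<in> Q \<Longrightarrow> norm q \<le> b"
proof -
  define F where "F n = {z \<in> V. \<forall>q\<in>Q. norm (cinner z q) \<le> real n}" for n :: nat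
  have cover: "\<Union>(range F) = V"
    using pointwise real_arch_simple by (fastforce simp: F_def intro: order_trans)
  have "closedin (top_of_set V) (F n)" for n
  proof -
    have "F n = V \<inter> (\<Inter>q\<in>Q. {z. norm (cinner z q) \<le> real n})"
      by (auto simp: F_def)
    moreover have "closed {z. norm (cinner z q) \<le> real n}" for q :: 'a
      by (intro closed_Collect_le continuous_intros
          bounded_bilinear.continuous_on[OF bounded_bilinear_cinner])
    ultimately show ?thesis
      by (auto intro!: closedin_closed_Int)
  qed
  moreover have "top_of_set V interior_of \<Union>(range F) \<noteq> {}"
    using csubspace_0[OF V(1)] by (metis cover empty_iff interior_of_topspace topspace_euclidean_subtopology)
  ultimately obtain n where "top_of_set V interior_of F n \<noteq> {}"
    using Baire_category_alt[OF disjI1[OF completely_metrizable_space_complete[OF V(2)]], of "range F"]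
    by auto
  then obtain a U where "openin (top_of_set V) U" "U \<subseteq> F n" "a \<in> U"
    by (auto simp: interior_of_def)
  then obtain e where a: "a \<in> V" and "e > 0" and ball: "ball a e \<inter> V \<subseteq> F n"
    by (metis openin_contains_ball openin_euclidean_subtopology_iff order_trans subsetD)
  have "norm q \<le> 4 * real n / e" if q: "q \<in> Q" for q
  proof (cases "q = 0")
    case False
    \<comment> \<open>A vector of length \<open>e / 2\<close> in the direction of \<open>q\<close>,
      so that \<open>a + z\<close> stays in the ball. Pairing it with \<open>q\<close> gives
      \<open>e * norm q / 2\<close>, which is at most \<open>2 * n\<close>.\<close>
    define z where "z = (e / (2 * norm q)) *\<^sub>R q"
    have "z \<in> V"
      using q \<open>Q \<subseteq> V\<close> csubspace_imp_subspace[OF V(1)] by (auto simp: z_def intro: subspace_scale)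
    moreover have "norm z < e"
      using False \<open>e > 0\<close> by (simp add: z_def)
    ultimately have "a \<in> F n" "a + z \<in> F n"
      using ball a \<open>e > 0\<close> csubspace_add[OF V(1)] by (auto simp: dist_norm subset_iff)
    then have "norm (cinner (a + z) q) \<le> n" "norm (cinner a q) \<le> n"
      using q by (auto simp: F_def)
    then have "norm (cinner z q) \<le> n + n"
      using norm_triangle_ineq4[of "cinner (a + z) q" "cinner a q"] by (simp add: cinner_add_left)
    also have "norm (cinner z q) = e * norm q / 2"
      using False \<open>e > 0\<close>
      by (simp add: z_def scaleR_scaleC cinner_scaleC_left cinner_self norm_mult power2_eq_square
          norm_divide)
    finally show ?thesis
      using \<open>e > 0\<close> by (simp add: field_simps)
  qed (use \<open>e > 0\<close> in simp)
  then show thesis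
    using that by blast
qed

text \<open>In the induction step the new vector is replaced by its part \<open>e\<close> orthogonal
  to the old span. Pairing with \<open>e\<close> bounds the coefficients, so they converge along a
  subsequence, and the remainder falls under the induction hypothesis.\<close>

lemma finite_cspan_sequentially_compact:
  fixes B :: "'a::complex_inner set" and f :: "nat \<Rightarrow> 'a"
  assumes "finite B" "\<And>n. f n \<in> cspan B" "bounded (range f)"
  shows "\<exists>l\<in>cspan B. \<exists>r. strict_mono r \<and> (f \<circ> r) \<longlonglongrightarrow> l"
  using assms
proof (induction B arbitrary: f rule: finite_induct)
  case empty
  then have "f = (\<lambda>n. 0)"
    by auto
  then show ?case
    by (intro bexI[of _ 0] exI[of _ id]) (auto simp: strict_mono_def)
next
  case (insert b B)
  \<comment> \<open>Projecting \<open>b\<close> needs a complete old span. The induction hypothesis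
    supplies it: a Cauchy sequence is bounded and converges once a subsequence does.\<close>
  have "complete (cspan B)"
  proof (rule completeI)
    fix f :: "nat \<Rightarrow> 'a" assume f: "\<forall>n. f n \<in> cspan B" "Cauchy f"
    then obtain l r where "l \<in> cspan B" "strict_mono r" "(f \<circ> r) \<longlonglongrightarrow> l"
      using insert.IH[of f] cauchy_imp_bounded by blast
    then show "\<exists>l\<in>cspan B. f \<longlonglongrightarrow> l"
      using Cauchy_converges_subseq[OF f(2)] by blast
  qed
  then obtain y where y: "y \<in> cspan B" "\<And>z. z \<in> cspan B \<Longrightarrow> cinner (b - y) z = 0"
    using orthogonal_projection_exists[OF complex_vector.subspace_span] by metis
  define e where "e = b - y"
  have cspan_insert: "x \<in> cspan (insert b B) \<longleftrightarrow> (\<exists>c. x - c *\<^sub>C e \<in> cspan B)" for x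
  proof -
    have "x - c *\<^sub>C b = (x - c *\<^sub>C e) - c *\<^sub>C y" "x - c *\<^sub>C e = (x - c *\<^sub>C b) + c *\<^sub>C y" for c
      by (simp_all add: e_def scaleC_diff_right)
    then have "x - c *\<^sub>C b \<in> cspan B \<longleftrightarrow> x - c *\<^sub>C e \<in> cspan B" for c
      using complex_vector.span_add complex_vector.span_diff
        complex_vector.span_scale[OF y(1), of c] by metis
    then show ?thesis
      by (simp add: complex_vector.span_insert)
  qed
  show ?case
  proof (cases "e = 0")
    case True
    then have "cspan (insert b B) = cspan B"
      using cspan_insert by auto
    then show ?thesis
      using insert.IH insert.prems by simp
  next
    case False
    have "\<forall>n. \<exists>c. f n - c *\<^sub>C e \<in> cspan B"
      using insert.prems(1) cspan_insert by blast
    then obtain c where c: "\<And>n. f n - c n *\<^sub>C e \<in> cspan B"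
      using choice[of "\<lambda>n c. f n - c *\<^sub>C e \<in> cspan B"] by blast
    obtain K where K: "\<And>n. norm (f n) \<le> K"
      using insert.prems(2) by (auto simp: bounded_iff)
    have "norm (c n) \<le> K / norm e" for n
    proof -
      have "cinner (f n - c n *\<^sub>C e) e = 0"
        using y(2)[OF c] by (simp add: e_def cinner_eq_0_commute)
      then have "c n * (norm e)\<^sup>2 = cinner (f n) e"
        by (simp add: cinner_diff_left cinner_scaleC_left cinner_self)
      then have "norm (c n) * (norm e)\<^sup>2 = norm (cinner (f n) e)"
        by (metis norm_mult norm_of_real abs_power2 of_real_power)
      also have "\<dots> \<le> K * norm e"
        using norm_cinner_le K by (meson mult_right_mono norm_ge_zero order_trans)
      finally show ?thesis
        using False by (simp add: power2_eq_square field_simps)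
    qed
    then have "bounded (range c)"
      by (auto simp: bounded_iff)
    then obtain c0 r where r: "strict_mono r" "(c \<circ> r) \<longlonglongrightarrow> c0"
      using bounded_imp_convergent_subsequence by blast
    define g where "g n = f (r n) - c (r n) *\<^sub>C e" for n
    have "norm (g n) \<le> K + K / norm e * norm e" for n
      unfolding g_def using K[of "r n"] mult_right_mono[OF \<open>norm (c (r n)) \<le> K / norm e\<close>, of "norm e"]
      by (intro order_trans[OF norm_triangle_ineq4] add_mono) (auto simp: norm_scaleC)
    then have "bounded (range g)"
      by (auto simp: bounded_iff)
    then obtain l s where s: "l \<in> cspan B" "strict_mono s" "(g \<circ> s) \<longlonglongrightarrow> l"
      using insert.IH[of g] c unfolding g_def by blast
    have "(\<lambda>n. g (s n) + c (r (s n)) *\<^sub>C e) \<longlonglongrightarrow> l + c0 *\<^sub>C e"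
      using s(3) LIMSEQ_subseq_LIMSEQ[OF r(2) s(2)]
      by (intro tendsto_add tendsto_scaleC tendsto_const) (auto simp: o_def)
    then have "(f \<circ> (r \<circ> s)) \<longlonglongrightarrow> l + c0 *\<^sub>C e"
      by (simp add: g_def o_def)
    moreover have "l + c0 *\<^sub>C e \<in> cspan (insert b B)"
      using s(1) by (auto simp: cspan_insert intro!: exI[of _ c0])
    ultimately show ?thesis
      using strict_mono_o[OF r(1) s(2)] by blast
  qed
qed

section \<open>Bounded operators and self-adjoint relations\<close>

definition graph_on :: "'a set \<Rightarrow> ('a \<Rightarrow> 'b) \<Rightarrow> ('a \<times> 'b) set"
  where "graph_on V k = {(x, k x) | x. x \<in> V}"

lemma graph_on_iff [simp]: "(x, y) \<in> graph_on V k \<longleftrightarrow> x \<in> V \<and> y = k x"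
  by (auto simp: graph_on_def)

lemma clinear_on_diff:
  assumes "clinear_on V F" "csubspace V" "x \<in> V" "y \<in> V"
  shows "F (x - y) = F x - F y"
proof -
  have "F (x - y) + F y = F x"
    using assms csubspace_diff[OF assms(2-4)] unfolding clinear_on_def
    by (metis diff_add_cancel)
  then show ?thesis
    by (simp add: algebra_simps)
qed

lemma clinear_on_0:
  assumes "clinear_on V F" "csubspace V"
  shows "F 0 = 0"
  using clinear_on_diff[OF assms] csubspace_0[OF assms(2)] by fastforce

lemma bounded_ops_graphI:
  assumes V: "csubspace V" and k: "\<And>x. x \<in> V \<Longrightarrow> k x \<in> W" "clinear_on V k"
    and bound: "\<And>x. x \<in> V \<Longrightarrow> norm (k x) \<le> c * norm x"
  shows "graph_on V k \<in> bounded_ops V W"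
proof -
  have "csubspace (graph_on V k)"
    using V k(2) clinear_on_0[OF k(2) V] unfolding complex_vector.subspace_def clinear_on_def
    by (force simp: graph_on_def scaleC_prod_def zero_prod_def)
  then show ?thesis
    using k(1) bound
    by (auto simp: bounded_ops_def linear_relation_def single_valued_def graph_on_def)
qed

lemma bounded_ops_graphE:
  assumes "B \<in> bounded_ops V W"
  obtains k c where "B = graph_on V k" "\<And>x. x \<in> V \<Longrightarrow> k x \<in> W" "clinear_on V k"
    "\<And>x. x \<in> V \<Longrightarrow> norm (k x) \<le> c * norm x" "0 \<le> c"
proof -
  have B: "csubspace B" "B \<subseteq> V \<times> W" "single_valued B" "Domain B = V"
    using assms by (auto simp: bounded_ops_def linear_relation_def)
  obtain c where c: "\<And>x y. (x, y) \<in> B \<Longrightarrow> norm y \<le> c * norm x"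
    using assms by (auto simp: bounded_ops_def)
  define k where "k x = (SOME y. (x, y) \<in> B)" for x
  have k: "(x, k x) \<in> B" if "x \<in> V" for x
    unfolding k_def using that B(4) by (metis Domain.cases someI)
  have k_eq: "k x = y" if "(x, y) \<in> B" for x y
    using that k B by (metis Domain.DomainI single_valuedD)
  show thesis
  \<comment> \<open>The constant in \<open>bounded_ops\<close> carries no sign condition; its
    absolute value is a nonnegative bound.\<close>
  proof (rule that[of k "\<bar>c\<bar>"])
    show "B = graph_on V k"
      using B(4) k k_eq by (auto simp: graph_on_def)
    show "clinear_on V k"
      unfolding clinear_on_def
    proof (intro conjI ballI allI)
      fix x y assume "x \<in> V" "y \<in> V"
      then show "k (x + y) = k x + k y"
        using csubspace_add[OF B(1) k k] by (auto intro: k_eq)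
    next
      fix a x assume "x \<in> V"
      then show "k (a *\<^sub>C x) = a *\<^sub>C k x"
        using csubspace_scaleC[OF B(1) k] by (auto intro: k_eq simp: scaleC_prod_def)
    qed
    show "norm (k x) \<le> \<bar>c\<bar> * norm x" if "x \<in> V" for x
      using c[OF k[OF that]] by (meson abs_ge_self mult_right_mono norm_ge_zero order_trans)
  qed (use B k in auto)
qed

lemma bounded_clinear_tendsto:
  assumes k: "clinear_on V k" and V: "csubspace V"
    and bound: "\<And>x. x \<in> V \<Longrightarrow> norm (k x) \<le> c * norm x"
    and f: "\<And>n. f n \<in> V" "f \<longlonglongrightarrow> x" and x: "x \<in> V"
  shows "(\<lambda>n. k (f n)) \<longlonglongrightarrow> k x"
proof -
  have "(\<lambda>n. c * norm (f n - x)) \<longlonglongrightarrow> c * norm (x - x)"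
    by (intro tendsto_intros f)
  then have lim: "(\<lambda>n. c * norm (f n - x)) \<longlonglongrightarrow> 0"
    by simp
  have "norm (k (f n) - k x) \<le> c * norm (f n - x)" for n
    using bound[OF csubspace_diff[OF V f(1) x]] clinear_on_diff[OF k V f(1) x] by metis
  then have "(\<lambda>n. k (f n) - k x) \<longlonglongrightarrow> 0"
    by (intro Lim_null_comparison[OF _ lim] always_eventually allI)
  then show ?thesis
    by (rule LIM_zero_cancel)
qed

lemma Cauchy_lipschitz:
  fixes f :: "nat \<Rightarrow> 'a::real_normed_vector" and g :: "nat \<Rightarrow> 'b::real_normed_vector"
  assumes f: "Cauchy f" and le: "\<And>m n. norm (g m - g n) \<le> c * norm (f m - f n)"
  shows "Cauchy g"
proof (rule metric_CauchyI)
  fix e :: real assume "0 < e"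
  \<comment> \<open>The added 1 keeps the denominator positive whatever \<open>c\<close> is.\<close>
  then obtain N where N: "\<And>m n. m \<ge> N \<Longrightarrow> n \<ge> N \<Longrightarrow> dist (f m) (f n) < e / (\<bar>c\<bar> + 1)"
    using metric_CauchyD[OF f, of "e / (\<bar>c\<bar> + 1)"] by auto
  have "dist (g m) (g n) < e" if "m \<ge> N" "n \<ge> N" for m n
  proof -
    have "norm (g m - g n) \<le> (\<bar>c\<bar> + 1) * norm (f m - f n)"
      by (rule order_trans[OF le mult_right_mono]) simp_all
    also have "\<dots> < e"
      using N[OF that] by (simp add: dist_norm field_simps)
    finally show ?thesis
      by (simp add: dist_norm)
  qed
  then show "\<exists>N. \<forall>m\<ge>N. \<forall>n\<ge>N. dist (g m) (g n) < e"
    by blast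
qed

section \<open>Domains, ranges and adjoints of linear relations\<close>

lemma csubspace_Domain:
  assumes "csubspace S"
  shows "csubspace (Domain S)"
  unfolding complex_vector.subspace_def
proof (intro conjI ballI allI)
  show "0 \<in> Domain S"
    using csubspace_0[OF assms] by (auto simp: zero_prod_def)
  show "x + y \<in> Domain S" if "x \<in> Domain S" "y \<in> Domain S" for x y
    using that csubspace_add[OF assms] by fastforce
  show "a *\<^sub>C x \<in> Domain S" if "x \<in> Domain S" for a x
    using that csubspace_scaleC[OF assms, of _ a] by (fastforce simp: scaleC_prod_def)
qed

lemma csubspace_Range:
  assumes "csubspace S"
  shows "csubspace (Range S)"
  unfolding complex_vector.subspace_def
proof (intro conjI ballI allI)
  show "0 \<in> Range S"
    using csubspace_0[OF assms] by (auto simp: zero_prod_def)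
  show "x + y \<in> Range S" if "x \<in> Range S" "y \<in> Range S" for x y
    using that csubspace_add[OF assms] by fastforce
  show "a *\<^sub>C x \<in> Range S" if "x \<in> Range S" for a x
    using that csubspace_scaleC[OF assms, of _ a] by (fastforce simp: scaleC_prod_def)
qed

lemma hilbert_space_closed: "hilbert_space H \<Longrightarrow> closed H"
  by (simp add: hilbert_space_def complete_imp_closed)

lemma csubspace_adjoint_rel:
  assumes "csubspace H" "csubspace K"
  shows "csubspace (adjoint_rel H K S)"
  using assms unfolding complex_vector.subspace_def adjoint_rel_def case_prod_beta
  by (simp add: scaleC_prod_def cinner_add_right cinner_scaleC_right)

lemma closed_adjoint_rel:
  assumes "closed H" "closed K"
  shows "closed (adjoint_rel H K S)"
  unfolding closed_sequential_limits
proof (intro allI impI, elim conjE)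
  fix f l assume f: "\<forall>n. f n \<in> adjoint_rel H K S" "f \<longlonglongrightarrow> l"
  have lim: "(\<lambda>n. fst (f n)) \<longlonglongrightarrow> fst l" "(\<lambda>n. snd (f n)) \<longlonglongrightarrow> snd l"
    using f(2) by (auto intro: tendsto_fst tendsto_snd)
  have "fst (f n) \<in> K" "snd (f n) \<in> H" for n
    using f(1) by (auto simp: adjoint_rel_def case_prod_beta)
  then have "fst l \<in> K" "snd l \<in> H"
    using closed_sequentially[OF assms(2) _ lim(1)] closed_sequentially[OF assms(1) _ lim(2)] by auto
  moreover have "cinner b (fst l) = cinner a (snd l)" if "(a, b) \<in> S" for a b
  proof (rule LIMSEQ_unique)
    show "(\<lambda>n. cinner b (fst (f n))) \<longlonglongrightarrow> cinner b (fst l)"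
      by (intro tendsto_cinner tendsto_const lim)
    have "cinner b (fst (f n)) = cinner a (snd (f n))" for n
      using f(1) that by (force simp: adjoint_rel_def case_prod_beta)
    moreover have "(\<lambda>n. cinner a (snd (f n))) \<longlonglongrightarrow> cinner a (snd l)"
      by (intro tendsto_cinner tendsto_const lim)
    ultimately show "(\<lambda>n. cinner b (fst (f n))) \<longlonglongrightarrow> cinner a (snd l)"
      by simp
  qed
  ultimately show "l \<in> adjoint_rel H K S"
    by (auto simp: adjoint_rel_def case_prod_beta)
qed

lemma selfadjoint_relation_iff:
  assumes "selfadjoint_relation G \<Theta>"
  shows "(g, g') \<in> \<Theta> \<longleftrightarrow> g \<in> G \<and> g' \<in> G \<and> (\<forall>f f'. (f, f') \<in> \<Theta> \<longrightarrow> cinner f' g = cinner f g')"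
proof -
  have "(g, g') \<in> \<Theta> \<longleftrightarrow> (g, g') \<in> adjoint_rel G G \<Theta>"
    using assms by (simp add: selfadjoint_relation_def)
  then show ?thesis
    by (auto simp: adjoint_rel_def)
qed

lemma selfadjoint_relation_symmetric:
  assumes "selfadjoint_relation G \<Theta>" "(f, f') \<in> \<Theta>"
  shows "Im (cinner f' f) = 0"
proof -
  have "cinner f' f = cinner f f'"
    using assms selfadjoint_relation_iff by blast
  then show ?thesis
    using cinner_commute[of f f'] by (simp add: complex_eq_iff)
qed

lemma selfadjoint_relation_closed:
  assumes "hilbert_space G" "selfadjoint_relation G \<Theta>"
  shows "closed \<Theta>"
  using assms closed_adjoint_rel hilbert_space_closed unfolding selfadjoint_relation_def by metis

lemma selfadjoint_relation_csubspace:
  "selfadjoint_relation G \<Theta> \<Longrightarrow> csubspace \<Theta>"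
  by (simp add: selfadjoint_relation_def linear_relation_def)

text \<open>The lower bound makes \<open>W\<close>, the inverse of \<Theta> - k, single-valued and
  bounded, and with closedness of \<Theta> it makes \<open>Domain W\<close> complete. If \<omega> is
  orthogonal to \<open>Domain W\<close>, the pair of \<omega> and its image under the adjoint of
  \<open>k\<close> lies in the adjoint of \<Theta>, hence in \<Theta>, so the form of
  \<open>k\<close> at \<omega> is real and \<open>strict\<close> applies. The lemma serves both for
  a compact \<open>k\<close> and for multiplication by a nonreal number.\<close>

lemma selfadjoint_inverse_bounded:
  fixes G :: "'a::complex_inner set"
  assumes G: "hilbert_space G" and \<Theta>: "selfadjoint_relation G \<Theta>"
    and k: "graph_on G k \<in> bounded_ops G G"
    and below: "\<And>\<phi> \<theta>. (\<phi>, \<theta>) \<in> \<Theta> \<Longrightarrow> norm \<phi> \<le> c * norm (\<theta> - k \<phi>)"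
    and strict: "\<And>\<omega>. \<omega> \<in> G \<Longrightarrow> Im (cinner (k \<omega>) \<omega>) = 0 \<Longrightarrow> \<omega> = 0"
  shows "{(\<theta> - k \<phi>, \<phi>) | \<phi> \<theta>. (\<phi>, \<theta>) \<in> \<Theta>} \<in> bounded_ops G G"
proof -
  have sG: "csubspace G" and cG: "complete G"
    using G by (auto simp: hilbert_space_def)
  have s\<Theta>: "csubspace \<Theta>" and \<Theta>G: "\<Theta> \<subseteq> G \<times> G"
    using \<Theta> by (auto simp: selfadjoint_relation_def linear_relation_def)
  have closed\<Theta>: "closed \<Theta>"
    using G \<Theta> by (rule selfadjoint_relation_closed)
  \<comment> \<open>Unpacking the graph yields some function with that graph; it agrees with
    \<open>k\<close> on \<open>G\<close>, which transfers linearity and the bound to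
    \<open>k\<close>.\<close>
  obtain k' b where kk': "graph_on G k = graph_on G k'" and k'G: "\<And>x. x \<in> G \<Longrightarrow> k' x \<in> G"
    and k'lin: "clinear_on G k'" and k'b: "\<And>x. x \<in> G \<Longrightarrow> norm (k' x) \<le> b * norm x"
    using bounded_ops_graphE[OF k] by metis
  have k_eq: "k x = k' x" if "x \<in> G" for x
    using kk' that by (metis graph_on_iff)
  have kG: "\<And>x. x \<in> G \<Longrightarrow> k x \<in> G" and kb: "\<And>x. x \<in> G \<Longrightarrow> norm (k x) \<le> b * norm x"
    and klin: "clinear_on G k"
    using k'G k'b k'lin sG by (auto simp: k_eq clinear_on_def csubspace_add csubspace_scaleC)
  define W where "W = {(\<theta> - k \<phi>, \<phi>) | \<phi> \<theta>. (\<phi>, \<theta>) \<in> \<Theta>}"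
  have WG: "W \<subseteq> G \<times> G"
    using \<Theta>G kG csubspace_diff[OF sG] by (auto simp: W_def)
  have sW: "csubspace W"
    unfolding complex_vector.subspace_def
  proof (intro conjI ballI allI)
    show "0 \<in> W"
      using csubspace_0[OF s\<Theta>] clinear_on_0[OF klin sG] by (force simp: W_def zero_prod_def)
  next
    fix x y assume "x \<in> W" "y \<in> W"
    then obtain \<phi> \<theta> \<phi>' \<theta>' where xy: "x = (\<theta> - k \<phi>, \<phi>)" "y = (\<theta>' - k \<phi>', \<phi>')"
      and mem: "(\<phi>, \<theta>) \<in> \<Theta>" "(\<phi>', \<theta>') \<in> \<Theta>"
      by (auto simp: W_def)
    have "k (\<phi> + \<phi>') = k \<phi> + k \<phi>'"
      using klin mem \<Theta>G unfolding clinear_on_def by blast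
    moreover have "(\<phi> + \<phi>', \<theta> + \<theta>') \<in> \<Theta>"
      using csubspace_add[OF s\<Theta> mem] by simp
    ultimately show "x + y \<in> W"
      by (force simp: W_def xy)
  next
    fix a x assume "x \<in> W"
    then obtain \<phi> \<theta> where x: "x = (\<theta> - k \<phi>, \<phi>)" and mem: "(\<phi>, \<theta>) \<in> \<Theta>"
      by (auto simp: W_def)
    have "k (a *\<^sub>C \<phi>) = a *\<^sub>C k \<phi>"
      using klin mem \<Theta>G by (auto simp: clinear_on_def)
    moreover have "(a *\<^sub>C \<phi>, a *\<^sub>C \<theta>) \<in> \<Theta>"
      using csubspace_scaleC[OF s\<Theta> mem] by (simp add: scaleC_prod_def)
    ultimately show "a *\<^sub>C x \<in> W"
      by (force simp: W_def x scaleC_prod_def scaleC_diff_right)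
  qed
  have W_bound: "norm y \<le> c * norm x" if "(x, y) \<in> W" for x y
    using below that by (auto simp: W_def)
  have "single_valued W"
  proof (rule single_valuedI)
    fix x y z assume "(x, y) \<in> W" "(x, z) \<in> W"
    then have "(0, y - z) \<in> W"
      using csubspace_diff[OF sW] by fastforce
    from W_bound[OF this] show "y = z"
      by simp
  qed
  have sD: "csubspace (Domain W)"
    using sW by (rule csubspace_Domain)
  have "complete (Domain W)"
  proof (rule completeI)
    fix f assume "\<forall>n. f n \<in> Domain W" and f: "Cauchy f"
    then have "\<forall>n. \<exists>\<phi> \<theta>. (\<phi>, \<theta>) \<in> \<Theta> \<and> f n = \<theta> - k \<phi>"
      unfolding W_def by blast
    then obtain \<phi> \<theta> where mem: "\<And>n. (\<phi> n, \<theta> n) \<in> \<Theta>" and f_eq: "\<And>n. f n = \<theta> n - k (\<phi> n)"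
      by metis
    have \<phi>G: "\<phi> n \<in> G" and fG: "f n \<in> G" for n
      using mem \<Theta>G WG \<open>\<forall>n. f n \<in> Domain W\<close> by auto
    obtain f0 where f0: "f0 \<in> G" "f \<longlonglongrightarrow> f0"
      using f fG cG unfolding complete_def by blast
    have "(f n, \<phi> n) \<in> W" for n
      using mem by (auto simp: W_def f_eq)
    then have diff_le: "norm (\<phi> m - \<phi> n) \<le> c * norm (f m - f n)" for m n
      using csubspace_diff[OF sW] W_bound by (metis diff_Pair)
    have "Cauchy \<phi>"
      using f diff_le by (rule Cauchy_lipschitz)
    then obtain \<phi>0 where \<phi>0: "\<phi>0 \<in> G" "\<phi> \<longlonglongrightarrow> \<phi>0"
      using \<phi>G cG unfolding complete_def by blast
    have "(\<lambda>n. f n + k (\<phi> n)) \<longlonglongrightarrow> f0 + k \<phi>0"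
      by (intro tendsto_add f0 bounded_clinear_tendsto[OF klin sG kb] \<phi>G \<phi>0)
    then have "(\<lambda>n. (\<phi> n, \<theta> n)) \<longlonglongrightarrow> (\<phi>0, f0 + k \<phi>0)"
      using \<phi>0 by (intro tendsto_Pair) (auto simp: f_eq)
    then have "(\<phi>0, f0 + k \<phi>0) \<in> \<Theta>"
      using closed_sequentially[OF closed\<Theta>, of "\<lambda>n. (\<phi> n, \<theta> n)"] mem by blast
    then have "(f0, \<phi>0) \<in> W"
      by (force simp: W_def)
    then show "\<exists>l\<in>Domain W. f \<longlonglongrightarrow> l"
      using f0 by blast
  qed
  moreover have "\<omega> = 0" if \<omega>: "\<omega> \<in> G" "\<And>z. z \<in> Domain W \<Longrightarrow> cinner \<omega> z = 0" for \<omega>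
  proof -
    have "clinear_on G (\<lambda>\<phi>. cinner (k \<phi>) \<omega>)"
      using klin by (auto simp: clinear_on_def cinner_add_left cinner_scaleC_left scaleC_complex_def)
    moreover have "norm (cinner (k \<phi>) \<omega>) \<le> (b * norm \<omega>) * norm \<phi>" if "\<phi> \<in> G" for \<phi>
      using order_trans[OF norm_cinner_le mult_right_mono[OF kb[OF that] norm_ge_zero[of \<omega>]]]
      by (simp add: mult_ac)
    \<comment> \<open>This is the image of \<omega> under the adjoint of \<open>k\<close>, obtained
      pointwise from Riesz.\<close>
    ultimately obtain \<omega>' where \<omega>': "\<omega>' \<in> G" "\<And>\<phi>. \<phi> \<in> G \<Longrightarrow> cinner (k \<phi>) \<omega> = cinner \<phi> \<omega>'"
      using riesz_representation[OF sG cG] by blast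
    have "cinner \<theta> \<omega> = cinner \<phi> \<omega>'" if mem: "(\<phi>, \<theta>) \<in> \<Theta>" for \<phi> \<theta>
    proof -
      have "cinner \<omega> (\<theta> - k \<phi>) = 0"
        using mem \<omega>(2) by (auto simp: W_def)
      then have "cinner (\<theta> - k \<phi>) \<omega> = 0"
        by (simp add: cinner_eq_0_commute)
      then show ?thesis
        using \<omega>' mem \<Theta>G by (auto simp: cinner_diff_left)
    qed
    then have "(\<omega>, \<omega>') \<in> \<Theta>"
      using \<omega> \<omega>' selfadjoint_relation_iff[OF \<Theta>] by blast
    then have "Im (cinner \<omega> \<omega>') = 0"
      using selfadjoint_relation_symmetric[OF \<Theta>] cinner_commute[of \<omega> \<omega>'] by simp
    then show ?thesis
      using strict[OF \<omega>(1)] \<omega>'(2)[OF \<omega>(1)] by metis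
  qed
  moreover have "Domain W \<subseteq> G"
    using WG by auto
  ultimately have "Domain W = G"
    using orthogonal_complement_trivial_imp_closure_eq[OF cG sD _ sG]
    by (metis (no_types, lifting) closure_closed complete_imp_closed)
  then show ?thesis
    using sW WG \<open>single_valued W\<close> W_bound unfolding W_def[symmetric] bounded_ops_def linear_relation_def
    by blast
qed

section \<open>Compact perturbations of Fredholm relations\<close>

text \<open>The role of the open mapping theorem is taken by uniform boundedness. A vector
  \<open>q\<close> orthogonal to the kernel lies in the closed range of the operator part, and for
  \<open>z\<close> in this range, with \<open>w\<close> mapped to \<open>z\<close>, symmetry gives
  \<open>cinner z q = cinner w \<theta>\<close>. So the vectors \<open>q\<close> with
  \<open>norm \<theta> \<le> 1\<close> are weakly bounded, hence bounded.\<close>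

lemma selfadjoint_fredholm_bounded_below:
  fixes G :: "'a::complex_inner set"
  assumes G: "hilbert_space G" and \<Theta>: "selfadjoint_relation G \<Theta>"
    and closed_range: "closed (Range (op_part \<Theta>))"
  obtains C where "\<And>q \<theta>. (q, \<theta>) \<in> \<Theta> \<Longrightarrow> (\<And>n. (n, 0) \<in> \<Theta> \<Longrightarrow> cinner q n = 0) \<Longrightarrow>
    norm q \<le> C * norm \<theta>"
proof -
  define D where "D = closure (Domain \<Theta>)"
  define R where "R = op_part \<Theta>"
  have sG: "csubspace G" and cG: "complete G"
    using G by (auto simp: hilbert_space_def)
  note s\<Theta> = selfadjoint_relation_csubspace[OF \<Theta>]
  note \<Theta>_iff = selfadjoint_relation_iff[OF \<Theta>]
  have \<Theta>G: "f \<in> G" "f' \<in> G" if "(f, f') \<in> \<Theta>" for f f'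
    using that \<Theta>_iff by blast+
  have DG: "D \<subseteq> G"
    unfolding D_def using hilbert_space_closed[OF G] \<Theta>G by (intro closure_minimal) auto
  have sD: "csubspace D"
    unfolding D_def by (intro csubspace_closure csubspace_Domain s\<Theta>)
  have cD: "complete D"
    by (rule complete_closed_subset[OF _ DG cG]) (simp add: D_def)
  have R_iff: "(f, f') \<in> R \<longleftrightarrow> (f, f') \<in> \<Theta> \<and> f' \<in> D" for f f'
    using closure_subset[of "Domain \<Theta>"] by (auto simp: R_def op_part_def D_def)
  have "csubspace R"
    using s\<Theta> sD unfolding complex_vector.subspace_def
    by (simp add: split_paired_all Ball_def R_iff zero_prod_def scaleC_prod_def)
  then have sR: "csubspace (Range R)"
    by (rule csubspace_Range)
  have RD: "Range R \<subseteq> D"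
    by (auto simp: R_iff)
  have cR: "complete (Range R)"
    using closed_range RD cD unfolding R_def by (rule complete_closed_subset)
  \<comment> \<open>Splits off the multivalued part: \<open>f' - f1\<close> is orthogonal to the
    domain, so the pair \<open>(0, f' - f1)\<close> belongs to the adjoint, which is
    \<Theta>.\<close>
  have split: "\<exists>f1. (f, f1) \<in> R \<and> (\<forall>z\<in>D. cinner (f' - f1) z = 0)" if f: "(f, f') \<in> \<Theta>" for f f'
  proof -
    obtain f1 where f1: "f1 \<in> D" "\<And>z. z \<in> D \<Longrightarrow> cinner (f' - f1) z = 0"
      using orthogonal_projection_exists[OF sD cD, of f'] by blast
    have "cinner a (f' - f1) = 0" if "(a, b) \<in> \<Theta>" for a b
    proof -
      have "a \<in> D"
        using that closure_subset[of "Domain \<Theta>"] by (auto simp: D_def)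
      then show ?thesis
        using f1(2) cinner_eq_0_commute by blast
    qed
    moreover have "f' - f1 \<in> G"
      using csubspace_diff[OF sG] f1(1) DG \<Theta>G[OF f] by blast
    ultimately have "(0, f' - f1) \<in> \<Theta>"
      using csubspace_0[OF sG] by (subst \<Theta>_iff) simp
    from csubspace_diff[OF s\<Theta> f this] have "(f, f1) \<in> \<Theta>"
      by simp
    then show ?thesis
      using f1 by (auto simp: R_iff)
  qed
  define Q where "Q = {q. \<exists>\<theta>. (q, \<theta>) \<in> \<Theta> \<and> (\<forall>n. (n, 0) \<in> \<Theta> \<longrightarrow> cinner q n = 0) \<and> norm \<theta> \<le> 1}"
  \<comment> \<open>With \<open>p\<close> the projection of \<open>q\<close> onto
    \<open>Range R\<close>, the vector \<open>q - p\<close> is orthogonal to the whole range of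
    \<Theta> by \<open>split\<close>, hence in the kernel. Both \<open>q\<close> and
    \<open>p\<close> are orthogonal to the kernel, so \<open>q - p\<close> is orthogonal to
    itself.\<close>
  have "Q \<subseteq> Range R"
  proof
    fix q assume "q \<in> Q"
    then obtain \<theta> where q: "(q, \<theta>) \<in> \<Theta>" "\<And>n. (n, 0) \<in> \<Theta> \<Longrightarrow> cinner q n = 0"
      by (auto simp: Q_def)
    obtain p where p: "p \<in> Range R" "\<And>z. z \<in> Range R \<Longrightarrow> cinner (q - p) z = 0"
      using orthogonal_projection_exists[OF sR cR, of q] by blast
    have "q \<in> D"
      using q(1) closure_subset[of "Domain \<Theta>"] by (auto simp: D_def)
    then have qpD: "q - p \<in> D"
      using p(1) RD csubspace_diff[OF sD] by blast
    have "cinner f' (q - p) = 0" if "(f, f') \<in> \<Theta>" for f f'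
    proof -
      obtain f1 where "(f, f1) \<in> R" "\<forall>z\<in>D. cinner (f' - f1) z = 0"
        using split[OF \<open>(f, f') \<in> \<Theta>\<close>] by blast
      then have "cinner (f' - f1) (q - p) = 0" "cinner f1 (q - p) = 0"
        using qpD p(2) cinner_eq_0_commute by blast+
      then show ?thesis
        by (simp add: cinner_diff_left)
    qed
    then have ker: "(q - p, 0) \<in> \<Theta>"
      using qpD DG csubspace_0[OF sG] by (subst \<Theta>_iff) auto
    obtain a where "(a, p) \<in> R"
      using p(1) by blast
    then have "cinner p (q - p) = cinner a 0"
      using ker \<Theta>_iff R_iff by blast
    then have "cinner (q - p) (q - p) = 0"
      using q(2)[OF ker] by (subst cinner_diff_left) simp
    then have "q = p"
      by (simp add: cinner_self_eq_0)
    then show "q \<in> Range R"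
      using p(1) by simp
  qed
  moreover have "\<exists>b. \<forall>q\<in>Q. norm (cinner z q) \<le> b" if "z \<in> Range R" for z
  proof -
    obtain w where w: "(w, z) \<in> \<Theta>"
      using \<open>z \<in> Range R\<close> R_iff by blast
    have "norm (cinner z q) \<le> norm w" if "q \<in> Q" for q
    proof -
      obtain \<theta> where \<theta>: "(q, \<theta>) \<in> \<Theta>" "norm \<theta> \<le> 1"
        using \<open>q \<in> Q\<close> by (auto simp: Q_def)
      then have "cinner z q = cinner w \<theta>"
        using w \<Theta>_iff by blast
      then show ?thesis
        using norm_cinner_le[of w \<theta>] mult_left_mono[OF \<theta>(2), of "norm w"] by simp
    qed
    then show ?thesis
      by blast
  qed
  ultimately obtain b where b: "\<And>q. q \<in> Q \<Longrightarrow> norm q \<le> b"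
    using uniform_boundedness[OF sR cR] by metis
  have "norm q \<le> b * norm \<theta>"
    if q: "(q, \<theta>) \<in> \<Theta>" "\<And>n. (n, 0) \<in> \<Theta> \<Longrightarrow> cinner q n = 0" for q \<theta>
  proof (cases "\<theta> = 0")
    case True
    then show ?thesis
      using q cinner_self_eq_0[of q] by simp
  next
    case False
    define t where "t = inverse (norm \<theta>)"
    have "(t *\<^sub>R q, t *\<^sub>R \<theta>) \<in> \<Theta>"
      using subspace_scale[OF csubspace_imp_subspace[OF s\<Theta>] q(1), of t] by simp
    moreover have "cinner (t *\<^sub>R q) n = 0" if "(n, 0) \<in> \<Theta>" for n
      using q(2)[OF that] by (simp add: scaleR_scaleC cinner_scaleC_left)
    moreover have "norm (t *\<^sub>R \<theta>) \<le> 1"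
      using False by (simp add: t_def)
    ultimately have "t *\<^sub>R q \<in> Q"
      unfolding Q_def by blast
    from b[OF this] show ?thesis
      using False by (simp add: t_def field_simps)
  qed
  then show thesis
    using that by blast
qed

text \<open>Remove from each \<open>\<phi> n\<close> its projection \<open>p n\<close> onto the
  kernel. The remainders are Cauchy by the lower bound on the complement of the kernel; the
  projections are bounded in a finite-dimensional space.\<close>

lemma selfadjoint_fredholm_convergent_subsequence:
  fixes G :: "'a::complex_inner set"
  assumes G: "hilbert_space G" and \<Theta>: "selfadjoint_relation G \<Theta>"
    and ess: "0 \<notin> essential_spectrum \<Theta>"
    and mem: "\<And>n. (\<phi> n, \<theta> n) \<in> \<Theta>" and bdd: "bounded (range \<phi>)" and lim: "\<theta> \<longlonglongrightarrow> \<eta>"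
  obtains r l where "strict_mono r" "(\<phi> \<circ> r) \<longlonglongrightarrow> l"
proof -
  have sG: "csubspace G" and cG: "complete G"
    using G by (auto simp: hilbert_space_def)
  note s\<Theta> = selfadjoint_relation_csubspace[OF \<Theta>]
  have \<Theta>G: "f \<in> G" "f' \<in> G" if "(f, f') \<in> \<Theta>" for f f'
    using that selfadjoint_relation_iff[OF \<Theta>] by blast+
  have "shift_rel (op_part \<Theta>) 0 = op_part \<Theta>"
    by (auto simp: shift_rel_def)
  then obtain B where B: "finite B" "ker_rel (op_part \<Theta>) = cspan B" and "closed (Range (op_part \<Theta>))"
    using ess by (auto simp: essential_spectrum_def fredholm_def)
  obtain C where C: "\<And>q \<theta>. (q, \<theta>) \<in> \<Theta> \<Longrightarrow> (\<And>n. (n, 0) \<in> \<Theta> \<Longrightarrow> cinner q n = 0) \<Longrightarrow>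
    norm q \<le> C * norm \<theta>"
    using selfadjoint_fredholm_bounded_below[OF G \<Theta> \<open>closed (Range _)\<close>] by blast
  \<comment> \<open>Passing to the operator part keeps the kernel, because 0 lies in the closure of
    the domain.\<close>
  have ker: "(n, 0) \<in> \<Theta> \<longleftrightarrow> n \<in> cspan B" for n
    using csubspace_0[OF csubspace_closure[OF csubspace_Domain[OF s\<Theta>]]] closure_subset[of "Domain \<Theta>"]
    by (auto simp: B(2)[symmetric] ker_rel_def op_part_def)
  have "closed (cspan B)"
    unfolding closed_sequential_limits
  proof (intro allI impI, elim conjE)
    fix f l assume f: "\<forall>n. f n \<in> cspan B" "f \<longlonglongrightarrow> l"
    have "(\<lambda>n. (f n, 0 :: 'a)) \<longlonglongrightarrow> (l, 0)"
      by (intro tendsto_Pair f tendsto_const)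
    then have "(l, 0) \<in> \<Theta>"
      using closed_sequentially[OF selfadjoint_relation_closed[OF G \<Theta>], of "\<lambda>n. (f n, 0)"] f(1) ker
      by blast
    then show "l \<in> cspan B"
      by (simp add: ker)
  qed
  moreover have "cspan B \<subseteq> G"
    using ker \<Theta>G by blast
  ultimately have "complete (cspan B)"
    using complete_closed_subset cG by blast
  then have "\<forall>n. \<exists>p\<in>cspan B. \<forall>z\<in>cspan B. cinner (\<phi> n - p) z = 0"
    using orthogonal_projection_exists[OF complex_vector.subspace_span] by metis
  then obtain p where p: "\<And>n. p n \<in> cspan B" "\<And>n z. z \<in> cspan B \<Longrightarrow> cinner (\<phi> n - p n) z = 0"
    by metis
  have "norm ((\<phi> m - p m) - (\<phi> n - p n)) \<le> C * norm (\<theta> m - \<theta> n)" for m n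
  proof (rule C)
    have "(p n, 0) \<in> \<Theta>" for n
      using p(1) by (simp add: ker)
    then have "(\<phi> n - p n, \<theta> n) \<in> \<Theta>" for n
      using csubspace_diff[OF s\<Theta> mem[of n], of "(p n, 0)"] by simp
    then show "(\<phi> m - p m - (\<phi> n - p n), \<theta> m - \<theta> n) \<in> \<Theta>"
      using csubspace_diff[OF s\<Theta>, of "(\<phi> m - p m, \<theta> m)" "(\<phi> n - p n, \<theta> n)"] by simp
    show "cinner (\<phi> m - p m - (\<phi> n - p n)) z = 0" if "(z, 0) \<in> \<Theta>" for z
      using p(2) that by (subst cinner_diff_left) (simp add: ker)
  qed
  then have cauchy: "Cauchy (\<lambda>n. \<phi> n - p n)"
    by (rule Cauchy_lipschitz[OF LIMSEQ_imp_Cauchy[OF lim]])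
  moreover have "\<phi> n - p n \<in> G" for n
    using csubspace_diff[OF sG] \<Theta>G[OF mem] p(1) \<open>cspan B \<subseteq> G\<close> by blast
  ultimately obtain q where q: "(\<lambda>n. \<phi> n - p n) \<longlonglongrightarrow> q"
    using cG[unfolded complete_def, rule_format, of "\<lambda>n. \<phi> n - p n"] by blast
  have "bounded (range (\<lambda>n. \<phi> n - (\<phi> n - p n)))"
    using bounded_minus_comp[OF bdd cauchy_imp_bounded[OF cauchy]] by simp
  then have "bounded (range p)"
    by simp
  then obtain l r where r: "strict_mono r" "(p \<circ> r) \<longlonglongrightarrow> l"
    using finite_cspan_sequentially_compact[OF B(1), of p] p(1) by blast
  have "(\<lambda>n. (\<phi> (r n) - p (r n)) + p (r n)) \<longlonglongrightarrow> q + l"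
    using LIMSEQ_subseq_LIMSEQ[OF q r(1)] r(2) by (intro tendsto_add) (auto simp: o_def)
  then show thesis
    using that r(1) by (simp add: o_def)
qed

lemma compact_ops_convergent_subsequence:
  fixes f :: "nat \<Rightarrow> 'a::complex_inner"
  assumes K: "graph_on G k \<in> compact_ops G G'" and f: "\<And>n. f n \<in> G" "\<And>n. norm (f n) \<le> 1"
  obtains r l where "strict_mono r" "(\<lambda>n. k (f (r n))) \<longlonglongrightarrow> l"
proof -
  have "k (f n) \<in> closure (graph_on G k `` {f \<in> G. norm f \<le> 1})" for n
    using f closure_subset by (fastforce simp: graph_on_def)
  moreover have "compact (closure (graph_on G k `` {f \<in> G. norm f \<le> 1}))"
    using K by (simp add: compact_ops_def)
  ultimately obtain l r where "strict_mono r" "((\<lambda>n. k (f n)) \<circ> r) \<longlonglongrightarrow> l"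
    using compact_def[THEN iffD1, THEN spec, THEN mp, of _ "\<lambda>n. k (f n)"] by blast
  then show thesis
    using that by (simp add: o_def)
qed

text \<open>Failure of the lower bound gives unit vectors \<open>\<phi> n\<close> for which
  \<open>\<theta> n - k (\<phi> n)\<close> tends to 0. Compactness makes \<open>\<theta>\<close>
  converge along a subsequence, the Fredholm property then makes \<open>\<phi>\<close> converge, and
  the limit is a unit vector annihilated by \<Theta> - k. At such a vector the form of
  \<open>k\<close> is real by symmetry of \<Theta>, contrary to \<open>strict\<close>.\<close>

lemma fredholm_minus_compact_inverse_bounded:
  fixes G :: "'a::complex_inner set"
  assumes G: "hilbert_space G" and \<Theta>: "selfadjoint_relation G \<Theta>"
    and ess: "0 \<notin> essential_spectrum \<Theta>"
    and K: "graph_on G k \<in> compact_ops G G"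
    and strict: "\<And>\<phi>. \<phi> \<in> G \<Longrightarrow> Im (cinner (k \<phi>) \<phi>) = 0 \<Longrightarrow> \<phi> = 0"
  shows "{(\<theta> - k \<phi>, \<phi>) | \<phi> \<theta>. (\<phi>, \<theta>) \<in> \<Theta>} \<in> bounded_ops G G"
proof -
  have sG: "csubspace G"
    using G by (simp add: hilbert_space_def)
  note s\<Theta> = selfadjoint_relation_csubspace[OF \<Theta>]
  have \<Theta>G: "f \<in> G" "f' \<in> G" if "(f, f') \<in> \<Theta>" for f f'
    using that selfadjoint_relation_iff[OF \<Theta>] by blast+
  have Kb: "graph_on G k \<in> bounded_ops G G"
    using K by (simp add: compact_ops_def)
  obtain k' b where k': "graph_on G k = graph_on G k'" "clinear_on G k'"
    "\<And>x. x \<in> G \<Longrightarrow> norm (k' x) \<le> b * norm x"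
    using bounded_ops_graphE[OF Kb] by metis
  have k_eq: "k x = k' x" if "x \<in> G" for x
    using k'(1) that by (metis graph_on_iff)
  have scale: "k (t *\<^sub>R \<phi>) = t *\<^sub>R k \<phi>" if "\<phi> \<in> G" for t \<phi>
    using k'(2) that sG csubspace_scaleC[OF sG that]
    by (simp add: k_eq scaleR_scaleC clinear_on_def)
  have "\<exists>c. \<forall>\<phi> \<theta>. (\<phi>, \<theta>) \<in> \<Theta> \<longrightarrow> norm \<phi> \<le> c * norm (\<theta> - k \<phi>)"
  proof (rule ccontr)
    assume "\<not> ?thesis"
    then have "\<forall>n. \<exists>\<phi> \<theta>. (\<phi>, \<theta>) \<in> \<Theta> \<and> norm \<phi> > real (Suc n) * norm (\<theta> - k \<phi>)"
      by (metis not_less)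
    then obtain \<phi>' \<theta>' where mem': "\<And>n. (\<phi>' n, \<theta>' n) \<in> \<Theta>"
      and big: "\<And>n. norm (\<phi>' n) > real (Suc n) * norm (\<theta>' n - k (\<phi>' n))"
      by metis
    define t where "t n = inverse (norm (\<phi>' n))" for n
    define \<phi> where "\<phi> n = t n *\<^sub>R \<phi>' n" for n
    define \<theta> where "\<theta> n = t n *\<^sub>R \<theta>' n" for n
    \<comment> \<open>Strictness in \<open>big\<close> rules out the zero vector, so the
      normalization by \<open>t\<close> is legitimate.\<close>
    have pos: "norm (\<phi>' n) > 0" for n
      by (rule le_less_trans[OF _ big[of n]]) simp
    have mem: "(\<phi> n, \<theta> n) \<in> \<Theta>" for n
      using subspace_scale[OF csubspace_imp_subspace[OF s\<Theta>] mem'] by (simp add: \<phi>_def \<theta>_def)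
    have unit: "norm (\<phi> n) = 1" for n
      using pos[of n] by (simp add: \<phi>_def t_def)
    have "norm (\<theta> n - k (\<phi> n)) \<le> 1 / Suc n" for n
    proof -
      have "\<theta> n - k (\<phi> n) = t n *\<^sub>R (\<theta>' n - k (\<phi>' n))"
        using scale[OF \<Theta>G(1)[OF mem']] by (simp add: \<phi>_def \<theta>_def scaleR_diff_right)
      then show ?thesis
        using big[of n] pos[of n] by (simp only: norm_scaleR) (simp add: t_def field_simps)
    qed
    then have small: "(\<lambda>n. \<theta> n - k (\<phi> n)) \<longlonglongrightarrow> 0"
      by (intro Lim_null_comparison[OF _ LIMSEQ_Suc[OF lim_1_over_n]] always_eventually allI)
    obtain r \<eta> where r: "strict_mono r" "(\<lambda>n. k (\<phi> (r n))) \<longlonglongrightarrow> \<eta>"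
      using compact_ops_convergent_subsequence[OF K, of \<phi>] \<Theta>G(1)[OF mem] unit by (metis order_refl)
    have "(\<lambda>n. (\<theta> (r n) - k (\<phi> (r n))) + k (\<phi> (r n))) \<longlonglongrightarrow> 0 + \<eta>"
      using LIMSEQ_subseq_LIMSEQ[OF small r(1)] r(2) by (intro tendsto_add) (auto simp: o_def)
    then have \<theta>_lim: "(\<lambda>n. \<theta> (r n)) \<longlonglongrightarrow> \<eta>"
      by simp
    have "bounded (range (\<lambda>n. \<phi> (r n)))"
      using unit by (auto simp: bounded_iff intro!: exI[of _ 1])
    then obtain s \<phi>0 where s: "strict_mono s" "(\<lambda>n. \<phi> (r (s n))) \<longlonglongrightarrow> \<phi>0"
      using selfadjoint_fredholm_convergent_subsequence[OF G \<Theta> ess mem _ \<theta>_lim] by (auto simp: o_def)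
    have "(\<lambda>n. (\<phi> (r (s n)), \<theta> (r (s n)))) \<longlonglongrightarrow> (\<phi>0, \<eta>)"
      using LIMSEQ_subseq_LIMSEQ[OF \<theta>_lim s(1)] s(2) by (intro tendsto_Pair) (auto simp: o_def)
    then have \<phi>0\<Theta>: "(\<phi>0, \<eta>) \<in> \<Theta>"
      using closed_sequentially[OF selfadjoint_relation_closed[OF G \<Theta>],
          of "\<lambda>n. (\<phi> (r (s n)), \<theta> (r (s n)))"] mem by blast
    have "(\<lambda>n. k' (\<phi> (r (s n)))) \<longlonglongrightarrow> k' \<phi>0"
      by (intro bounded_clinear_tendsto[OF k'(2) sG k'(3)] \<Theta>G(1)[OF mem] s \<Theta>G(1)[OF \<phi>0\<Theta>])
    moreover have "(\<lambda>n. k' (\<phi> (r (s n)))) \<longlonglongrightarrow> \<eta>"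
      using LIMSEQ_subseq_LIMSEQ[OF r(2) s(1)] k_eq[OF \<Theta>G(1)[OF mem]] by (simp add: o_def)
    ultimately have "k \<phi>0 = \<eta>"
      using LIMSEQ_unique k_eq[OF \<Theta>G(1)[OF \<phi>0\<Theta>]] by metis
    then have "\<phi>0 = 0"
      using strict[OF \<Theta>G(1)[OF \<phi>0\<Theta>]] selfadjoint_relation_symmetric[OF \<Theta> \<phi>0\<Theta>] by metis
    moreover have "norm \<phi>0 = 1"
      using LIMSEQ_unique[OF tendsto_norm[OF s(2)]] unit by simp
    ultimately show False
      by simp
  qed
  then obtain c where "\<And>\<phi> \<theta>. (\<phi>, \<theta>) \<in> \<Theta> \<Longrightarrow> norm \<phi> \<le> c * norm (\<theta> - k \<phi>)"
    by blast
  then show ?thesis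
    using selfadjoint_inverse_bounded[OF G \<Theta> Kb] strict by blast
qed

section \<open>Separability of the boundary space\<close>

lemma compact_countable_dense_subset:
  fixes X :: "'a::metric_space set"
  assumes "compact X"
  obtains D where "countable D" "D \<subseteq> X" "X \<subseteq> closure D"
proof -
  have "\<forall>n. \<exists>k. finite k \<and> k \<subseteq> X \<and> X \<subseteq> (\<Union>x\<in>k. ball x (1 / Suc n))"
    using seq_compact_imp_totally_bounded[OF compact_imp_seq_compact[OF assms]] by simp
  then obtain k where k: "\<And>n. finite (k n)" "\<And>n. k n \<subseteq> X" "\<And>n. X \<subseteq> (\<Union>x\<in>k n. ball x (1 / Suc n))"
    by metis
  have "X \<subseteq> closure (\<Union>(range k))"
  proof
    fix x assume x: "x \<in> X"
    have "\<exists>y\<in>\<Union>(range k). dist y x < e" if e: "e > 0" for e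
    proof -
      obtain n where "1 / real (Suc n) < e"
        using e nat_approx_posE by blast
      moreover obtain y where "y \<in> k n" "dist y x < 1 / real (Suc n)"
        using k(3)[of n] x by auto
      ultimately show ?thesis
        by (intro bexI[of _ y]) auto
    qed
    then show "x \<in> closure (\<Union>(range k))"
      by (simp add: closure_approachable)
  qed
  then show thesis
    using that[of "\<Union>(range k)"] k by (auto simp: countable_finite)
qed

text \<open>Injectivity of the quadratic form makes the range of the compact operator dense.\<close>

lemma separable_hilbert_space_if_compact_op:
  fixes G :: "'a::complex_inner set"
  assumes G: "hilbert_space G" and K: "graph_on G k \<in> compact_ops G G"
    and form: "\<And>\<phi>. \<phi> \<in> G \<Longrightarrow> cinner (k \<phi>) \<phi> = 0 \<Longrightarrow> \<phi> = 0"
  shows "separable_hilbert_space G"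
proof -
  have sG: "csubspace G" and cG: "complete G"
    using G by (auto simp: hilbert_space_def)
  have Kb: "graph_on G k \<in> bounded_ops G G"
    using K by (simp add: compact_ops_def)
  have sR: "csubspace (graph_on G k)" and KG: "graph_on G k \<subseteq> G \<times> G"
    using Kb by (auto simp: bounded_ops_def linear_relation_def)
  have RG: "Range (graph_on G k) \<subseteq> G"
    using KG by auto
  have closure_range: "closure (Range (graph_on G k)) = G"
  proof (rule orthogonal_complement_trivial_imp_closure_eq[OF cG csubspace_Range[OF sR] RG sG])
    fix y assume y: "y \<in> G" "\<And>z. z \<in> Range (graph_on G k) \<Longrightarrow> cinner y z = 0"
    \<comment> \<open>A vector orthogonal to the range is in particular orthogonal to its own
      image.\<close>
    then have "cinner y (k y) = 0"
      by (metis Range.intros graph_on_iff)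
    then show "y = 0"
      using form[OF y(1)] by (simp add: cinner_eq_0_commute)
  qed
  define X where "X = closure (graph_on G k `` {f \<in> G. norm f \<le> 1})"
  have "compact X"
    using K by (simp add: X_def compact_ops_def)
  then obtain D where D: "countable D" "D \<subseteq> X" "X \<subseteq> closure D"
    using compact_countable_dense_subset by blast
  have "X \<subseteq> G"
    unfolding X_def using RG hilbert_space_closed[OF G] by (intro closure_minimal) auto
  \<comment> \<open>\<open>D\<close> is dense only in the closed image of the unit ball; integer
    multiples reach the whole range and keep the set countable.\<close>
  define E where "E = (\<Union>n::nat. (\<lambda>x. real n *\<^sub>R x) ` D)"
  have E: "countable E" "E \<subseteq> G"
    using D \<open>X \<subseteq> G\<close> subspace_scale[OF csubspace_imp_subspace[OF sG]] by (auto simp: E_def)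
  have "Range (graph_on G k) \<subseteq> closure E"
  proof
    fix y assume "y \<in> Range (graph_on G k)"
    then obtain x where x: "x \<in> G" "(x, y) \<in> graph_on G k"
      by auto
    obtain n :: nat where n: "norm x \<le> real n" "n > 0"
      using real_arch_simple[of "norm x"] by (metis le_add2 of_nat_mono order_trans plus_1_eq_Suc zero_less_Suc)
    have "(inverse (real n) *\<^sub>R x, inverse (real n) *\<^sub>R y) \<in> graph_on G k"
      using subspace_scale[OF csubspace_imp_subspace[OF sR] x(2)] by simp
    moreover have "norm (inverse (real n) *\<^sub>R x) \<le> 1"
      using n by (simp add: field_simps)
    ultimately have "inverse (real n) *\<^sub>R y \<in> graph_on G k `` {f \<in> G. norm f \<le> 1}"
      by (intro ImageI[of "inverse (real n) *\<^sub>R x"]) auto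
    then have "inverse (real n) *\<^sub>R y \<in> X"
      unfolding X_def by (rule subsetD[OF closure_subset])
    then have "real n *\<^sub>R (inverse (real n) *\<^sub>R y) \<in> (\<lambda>x. real n *\<^sub>R x) ` closure D"
      using D(3) by (intro imageI) blast
    then have "y \<in> closure ((\<lambda>x. real n *\<^sub>R x) ` D)"
      using n(2) by (simp add: closure_scaleR)
    then show "y \<in> closure E"
      using closure_mono[of "(\<lambda>x. real n *\<^sub>R x) ` D" E] by (auto simp: E_def)
  qed
  then have "G \<subseteq> closure E"
    using closure_range closure_minimal[OF _ closed_closure] by metis
  then have "separable_space (top_of_set G)"
    unfolding separable_space_def using E
    by (intro exI[of _ E]) (auto simp: closure_of_subtopology Int_absorb1)
  then show ?thesis
    using G by (simp add: separable_hilbert_space_def)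
qed

section \<open>Resolvents of self-adjoint relations\<close>

text \<open>Resolvent computations below take place inside \<open>S\<close> through this
  equivalence, so that they reduce to linear combinations of pairs.\<close>

lemma converse_shift_rel_iff: "(f, g) \<in> (shift_rel S l)\<inverse> \<longleftrightarrow> (g, f + l *\<^sub>C g) \<in> S"
  by (force simp: shift_rel_def)

lemma resolvent_set_unique:
  assumes "l \<in> resolvent_set H S" "(g, f + l *\<^sub>C g) \<in> S" "(h, f + l *\<^sub>C h) \<in> S"
  shows "g = h"
  using assms converse_shift_rel_iff[of f _ S l] unfolding resolvent_set_def bounded_ops_def
  by (metis (mono_tags, lifting) mem_Collect_eq single_valuedD)

lemma resolvent_set_exists:
  assumes "l \<in> resolvent_set H S" "f \<in> H"
  obtains g where "g \<in> H" "(g, f + l *\<^sub>C g) \<in> S"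
proof -
  have "(shift_rel S l)\<inverse> \<in> bounded_ops H H"
    using assms(1) by (simp add: resolvent_set_def)
  then obtain k where k: "(shift_rel S l)\<inverse> = graph_on H k" "\<And>x. x \<in> H \<Longrightarrow> k x \<in> H"
    using bounded_ops_graphE by metis
  then have "(f, k f) \<in> (shift_rel S l)\<inverse>"
    using assms(2) by simp
  then show thesis
    using that k(2)[OF assms(2)] converse_shift_rel_iff by blast
qed

text \<open>Apply \<open>selfadjoint_inverse_bounded\<close> to multiplication by \<open>l\<close>.
  The form of \<open>S\<close> is real, so the imaginary part of
  \<open>cinner (\<theta> - l *\<^sub>C \<phi>) \<phi>\<close> is
  \<open>- Im l * (norm \<phi>)\<^sup>2\<close>; this yields the lower bound, and
  \<open>Im l\<close> also yields strictness.\<close>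

lemma nonreal_in_resolvent_set:
  assumes H: "hilbert_space H" and S: "selfadjoint_relation H S" and l: "l \<notin> \<real>"
  shows "l \<in> resolvent_set H S"
proof -
  have Iml: "Im l \<noteq> 0"
    using l complex_is_Real_iff by blast
  have sH: "csubspace H"
    using H by (simp add: hilbert_space_def)
  have "graph_on H (\<lambda>x. l *\<^sub>C x) \<in> bounded_ops H H"
    using sH by (rule bounded_ops_graphI[where c = "norm l"])
      (auto simp: clinear_on_def csubspace_scaleC sH scaleC_add_right scaleC_scaleC mult.commute norm_scaleC)
  moreover have "norm \<phi> \<le> 1 / \<bar>Im l\<bar> * norm (\<theta> - l *\<^sub>C \<phi>)" if mem: "(\<phi>, \<theta>) \<in> S" for \<phi> \<theta>
  proof (cases "\<phi> = 0")
    case False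
    have "Im (cinner (\<theta> - l *\<^sub>C \<phi>) \<phi>) = - Im l * (norm \<phi>)\<^sup>2"
      using selfadjoint_relation_symmetric[OF S mem]
      by (simp add: cinner_diff_left cinner_scaleC_left cinner_self)
    then have "\<bar>Im l\<bar> * (norm \<phi>)\<^sup>2 \<le> norm (\<theta> - l *\<^sub>C \<phi>) * norm \<phi>"
      using abs_Im_le_cmod[of "cinner (\<theta> - l *\<^sub>C \<phi>) \<phi>"] norm_cinner_le[of "\<theta> - l *\<^sub>C \<phi>" \<phi>]
      by (simp add: abs_mult)
    then show ?thesis
      using False Iml by (simp add: power2_eq_square field_simps)
  qed simp
  moreover have "\<phi> = 0" if "Im (cinner (l *\<^sub>C \<phi>) \<phi>) = 0" for \<phi> :: 'a
    using that Iml by (simp add: cinner_scaleC_left cinner_self)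
  ultimately have "{(\<theta> - l *\<^sub>C \<phi>, \<phi>) | \<phi> \<theta>. (\<phi>, \<theta>) \<in> S} \<in> bounded_ops H H"
    by (rule selfadjoint_inverse_bounded[OF H S])
  also have "{(\<theta> - l *\<^sub>C \<phi>, \<phi>) | \<phi> \<theta>. (\<phi>, \<theta>) \<in> S} = (shift_rel S l)\<inverse>"
    by (auto simp: shift_rel_def)
  finally show ?thesis
    by (simp add: resolvent_set_def)
qed

text \<open>A real point is its own conjugate, and a nonreal conjugate lies in the resolvent set
  anyway; no adjoint of a resolvent has to be formed.\<close>

lemma selfadjoint_cnj_in_resolvent_set:
  assumes "hilbert_space H" "selfadjoint_relation H S" "l \<in> resolvent_set H S"
  shows "cnj l \<in> resolvent_set H S"
proof (cases "l \<in> \<real>")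
  case True
  then show ?thesis
    using assms(3) by (simp add: Reals_cnj_iff)
next
  case False
  then have "cnj l \<notin> \<real>"
    by (simp add: complex_is_Real_iff)
  then show ?thesis
    using nonreal_in_resolvent_set assms(1,2) by blast
qed

text \<open>The graph of I + c (S - l)^{-1}. With \<open>c\<close> a difference of two spectral
  parameters it is the factor that moves a solution from one parameter to the other.\<close>

definition id_plus_resolvent ::
  "'a::complex_inner set \<Rightarrow> ('a \<times> 'a) set \<Rightarrow> complex \<Rightarrow> complex \<Rightarrow> ('a \<times> 'a) set"
  where "id_plus_resolvent H S c l = {(f, f + c *\<^sub>C g) | f g. f \<in> H \<and> (g, f + l *\<^sub>C g) \<in> S}"

lemma id_plus_resolvent_bounded:
  assumes H: "csubspace H" and l: "l \<in> resolvent_set H S"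
  shows "id_plus_resolvent H S c l \<in> bounded_ops H H"
proof -
  have "(shift_rel S l)\<inverse> \<in> bounded_ops H H"
    using l by (simp add: resolvent_set_def)
  then obtain k b where k: "(shift_rel S l)\<inverse> = graph_on H k" "\<And>x. x \<in> H \<Longrightarrow> k x \<in> H"
    "clinear_on H k" "\<And>x. x \<in> H \<Longrightarrow> norm (k x) \<le> b * norm x"
    using bounded_ops_graphE by metis
  have "(g, f + l *\<^sub>C g) \<in> S \<longleftrightarrow> f \<in> H \<and> g = k f" for f g
    using k(1) converse_shift_rel_iff[of f g S l] by simp
  then have "id_plus_resolvent H S c l = graph_on H (\<lambda>f. f + c *\<^sub>C k f)"
    by (auto simp: id_plus_resolvent_def graph_on_def)
  also have "\<dots> \<in> bounded_ops H H"
  proof (rule bounded_ops_graphI[OF H, where c = "1 + norm c * b"])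
    show "f + c *\<^sub>C k f \<in> H" if "f \<in> H" for f
      using H k(2) that by (intro csubspace_add csubspace_scaleC)
    show "clinear_on H (\<lambda>f. f + c *\<^sub>C k f)"
      using k(3) by (simp add: clinear_on_def scaleC_add_right scaleC_scaleC mult.commute)
    show "norm (f + c *\<^sub>C k f) \<le> (1 + norm c * b) * norm f" if "f \<in> H" for f
      using norm_triangle_ineq[of f "c *\<^sub>C k f"] mult_left_mono[OF k(4)[OF that] norm_ge_zero[of c]]
      by (simp add: norm_scaleC algebra_simps)
  qed
  finally show ?thesis .
qed

lemma adjoint_rel_single_valued:
  assumes G: "csubspace G" and A: "Domain A = G"
  shows "single_valued (adjoint_rel G H A)"
proof (rule single_valuedI)
  fix f g h assume "(f, g) \<in> adjoint_rel G H A" "(f, h) \<in> adjoint_rel G H A"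
  then have gh: "g \<in> G" "h \<in> G" and eq: "\<And>x y. (x, y) \<in> A \<Longrightarrow> cinner x g = cinner x h"
    by (auto simp: adjoint_rel_def) (metis (mono_tags, lifting) case_prodD)
  then have "g - h \<in> Domain A"
    using G A csubspace_diff by blast
  then have "cinner (g - h) (g - h) = 0"
    using eq by (auto simp: cinner_diff_right)
  then show "g = h"
    by (simp add: cinner_self_eq_0)
qed

section \<open>Quasi boundary triples\<close>

text \<open>The operator $\Gamma_1 (A_0 - l)^{-1}$, which by Green's identity is $\gamma(\bar l)^*$.\<close>

definition gamma_adjoint ::
  "('a::complex_inner \<times> 'a) set \<Rightarrow> ('a \<times> 'a \<Rightarrow> 'a) \<Rightarrow> ('a \<times> 'a \<Rightarrow> 'a) \<Rightarrow> complex \<Rightarrow> ('a \<times> 'a) set"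
  where "gamma_adjoint T \<Gamma>0 \<Gamma>1 l = {(h' - l *\<^sub>C h, \<Gamma>1 (h, h')) | h h'. (h, h') \<in> ker_on T \<Gamma>0}"

context
  fixes H G :: "'a::complex_inner set" and A T :: "('a \<times> 'a) set" and \<Gamma>0 \<Gamma>1 :: "'a \<times> 'a \<Rightarrow> 'a"
  assumes H: "hilbert_space H" and triple: "quasi_boundary_triple H A G T \<Gamma>0 \<Gamma>1"
begin

lemma qbt_boundary_space: "hilbert_space G" and qbt_csubspace: "csubspace T"
  and qbt_linear: "clinear_on T \<Gamma>0" "clinear_on T \<Gamma>1"
  and qbt_selfadjoint_kernel: "selfadjoint_relation H (ker_on T \<Gamma>0)"
  using triple by (auto simp: quasi_boundary_triple_def)

lemma qbt_subset: "(f, f') \<in> T \<Longrightarrow> f \<in> H" "(f, f') \<in> T \<Longrightarrow> f' \<in> H"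
  using triple by (auto simp: quasi_boundary_triple_def adjoint_rel_def)

lemma qbt_mem: "x \<in> T \<Longrightarrow> \<Gamma>0 x \<in> G" "x \<in> T \<Longrightarrow> \<Gamma>1 x \<in> G"
  using triple by (auto simp: quasi_boundary_triple_def)

lemma qbt_green:
  assumes "(f, f') \<in> T" "(g, g') \<in> T"
  shows "cinner f' g - cinner f g' =
    cinner (\<Gamma>1 (f, f')) (\<Gamma>0 (g, g')) - cinner (\<Gamma>0 (f, f')) (\<Gamma>1 (g, g'))"
  using triple assms by (auto simp: quasi_boundary_triple_def)

lemmas qbt_diff0 = clinear_on_diff[OF qbt_linear(1) qbt_csubspace]
lemmas qbt_diff1 = clinear_on_diff[OF qbt_linear(2) qbt_csubspace]

lemma ker_on_iff: "x \<in> ker_on T \<Gamma>0 \<longleftrightarrow> x \<in> T \<and> \<Gamma>0 x = 0"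
  by (simp add: ker_on_def)

lemma qbt_range_dense:
  assumes "\<phi> \<in> G" "\<psi> \<in> G"
  obtains x where "\<And>n. x n \<in> T" "(\<lambda>n. \<Gamma>0 (x n)) \<longlonglongrightarrow> \<phi>" "(\<lambda>n. \<Gamma>1 (x n)) \<longlonglongrightarrow> \<psi>"
proof -
  have "(\<phi>, \<psi>) \<in> closure ((\<lambda>x. (\<Gamma>0 x, \<Gamma>1 x)) ` T)"
    using triple assms by (auto simp: quasi_boundary_triple_def)
  then obtain y where y: "\<And>n. y n \<in> (\<lambda>x. (\<Gamma>0 x, \<Gamma>1 x)) ` T" "y \<longlonglongrightarrow> (\<phi>, \<psi>)"
    unfolding closure_sequential by blast
  have "\<forall>n. \<exists>x\<in>T. y n = (\<Gamma>0 x, \<Gamma>1 x)"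
    using y(1) by blast
  then obtain x where x: "\<And>n. x n \<in> T" "\<And>n. y n = (\<Gamma>0 (x n), \<Gamma>1 (x n))"
    by metis
  show thesis
    using that[OF x(1)] tendsto_fst[OF y(2)] tendsto_snd[OF y(2)] by (simp add: x(2))
qed

text \<open>From \<open>x = (g, g')\<close> subtract the element of the kernel of
  \<open>\<Gamma>0\<close> with the same value of \<open>g' - l *\<^sub>C g\<close>; what is left
  lies in the defect space, with unchanged \<open>\<Gamma>0\<close>. Hence the \<gamma>-field and
  the Weyl function are defined on all of the range of \<open>\<Gamma>0\<close>.\<close>

lemma defect_decomposition:
  assumes l: "l \<in> resolvent_set H (ker_on T \<Gamma>0)" and x: "x \<in> T"
  obtains f where "(f, l *\<^sub>C f) \<in> T" "\<Gamma>0 (f, l *\<^sub>C f) = \<Gamma>0 x"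
proof -
  obtain g g' where g: "x = (g, g')"
    by (cases x)
  have sH: "csubspace H"
    using H by (simp add: hilbert_space_def)
  have "g' - l *\<^sub>C g \<in> H"
    using qbt_subset x csubspace_diff[OF sH] csubspace_scaleC[OF sH] by (auto simp: g)
  then obtain h where h: "(h, g' - l *\<^sub>C g + l *\<^sub>C h) \<in> ker_on T \<Gamma>0"
    using resolvent_set_exists[OF l] by blast
  have eq: "x - (h, g' - l *\<^sub>C g + l *\<^sub>C h) = (g - h, l *\<^sub>C (g - h))"
    by (simp add: g scaleC_diff_right)
  show thesis
    using that[of "g - h"] csubspace_diff[OF qbt_csubspace x] qbt_diff0[OF x] h by (metis ker_on_iff diff_zero eq)
qed

lemma gamma_field_iff: "(\<phi>, f) \<in> gamma_field T \<Gamma>0 l \<longleftrightarrow> (f, l *\<^sub>C f) \<in> T \<and> \<phi> = \<Gamma>0 (f, l *\<^sub>C f)"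
  by (auto simp: gamma_field_def defect_rel_def ker_rel_def shift_rel_def)

lemma weyl_function_iff:
  "(\<phi>, \<psi>) \<in> weyl_function T \<Gamma>0 \<Gamma>1 l \<longleftrightarrow>
    (\<exists>f. (f, l *\<^sub>C f) \<in> T \<and> \<phi> = \<Gamma>0 (f, l *\<^sub>C f) \<and> \<psi> = \<Gamma>1 (f, l *\<^sub>C f))"
  by (auto simp: weyl_function_def defect_rel_def ker_rel_def shift_rel_def)

text \<open>Since \<phi> need not be a boundary value, it is approximated by boundary values of
  defect elements \<open>f n\<close>. Green's identity of \<open>f n\<close> with itself shows that
  a real form at \<phi> forces \<open>f n\<close> to tend to 0. Green's identity against a fixed
  \<open>y\<close> then leaves a relation between \<phi> and the boundary values of \<open>y\<close>
  alone, which the dense joint range contradicts unless \<phi> = 0.\<close>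

lemma weyl_function_strict:
  assumes \<mu>: "\<mu> \<notin> \<real>" and K: "closure (weyl_function T \<Gamma>0 \<Gamma>1 \<mu>) = graph_on G k"
    and Kb: "graph_on G k \<in> bounded_ops G G"
    and \<phi>: "\<phi> \<in> G" "Im (cinner (k \<phi>) \<phi>) = 0"
  shows "\<phi> = 0"
proof -
  have sG: "csubspace G"
    using qbt_boundary_space by (simp add: hilbert_space_def)
  obtain k' b where k': "graph_on G k = graph_on G k'" "clinear_on G k'"
    "\<And>x. x \<in> G \<Longrightarrow> norm (k' x) \<le> b * norm x"
    using bounded_ops_graphE[OF Kb] by metis
  have k_eq: "k x = k' x" if "x \<in> G" for x
    using k'(1) that by (metis graph_on_iff)
  have res: "\<mu> \<in> resolvent_set H (ker_on T \<Gamma>0)"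
    using H qbt_selfadjoint_kernel \<mu> by (rule nonreal_in_resolvent_set)
  obtain x where x: "\<And>n. x n \<in> T" "(\<lambda>n. \<Gamma>0 (x n)) \<longlonglongrightarrow> \<phi>"
    using qbt_range_dense[OF \<phi>(1) csubspace_0[OF sG]] by metis
  have "\<forall>n. \<exists>f. (f, \<mu> *\<^sub>C f) \<in> T \<and> \<Gamma>0 (f, \<mu> *\<^sub>C f) = \<Gamma>0 (x n)"
    using defect_decomposition[OF res x(1)] by metis
  then obtain f where f: "\<And>n. (f n, \<mu> *\<^sub>C f n) \<in> T" "\<And>n. \<Gamma>0 (f n, \<mu> *\<^sub>C f n) = \<Gamma>0 (x n)"
    by metis
  define \<phi>' where "\<phi>' = (\<lambda>n. \<Gamma>0 (x n))"
  have \<phi>'G: "\<phi>' n \<in> G" for n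
    using qbt_mem(1)[OF x(1)] by (simp add: \<phi>'_def)
  have \<Gamma>1_f: "\<Gamma>1 (f n, \<mu> *\<^sub>C f n) = k' (\<phi>' n)" for n
  proof -
    have "(\<phi>' n, \<Gamma>1 (f n, \<mu> *\<^sub>C f n)) \<in> weyl_function T \<Gamma>0 \<Gamma>1 \<mu>"
      unfolding weyl_function_iff \<phi>'_def using f by metis
    then have "(\<phi>' n, \<Gamma>1 (f n, \<mu> *\<^sub>C f n)) \<in> graph_on G k'"
      using K k'(1) closure_subset by blast
    then show ?thesis
      by simp
  qed
  have lim\<phi>: "\<phi>' \<longlonglongrightarrow> \<phi>"
    using x(2) by (simp add: \<phi>'_def)
  have limk: "(\<lambda>n. k' (\<phi>' n)) \<longlonglongrightarrow> k' \<phi>"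
    by (rule bounded_clinear_tendsto[OF k'(2) sG k'(3) \<phi>'G lim\<phi> \<phi>(1)])
  have green_f: "cinner (\<mu> *\<^sub>C f n) g - cinner (f n) g' =
      cinner (k' (\<phi>' n)) (\<Gamma>0 (g, g')) - cinner (\<phi>' n) (\<Gamma>1 (g, g'))" if "(g, g') \<in> T" for n g g'
    using qbt_green[OF f(1) that] by (simp add: \<Gamma>1_f f(2) \<phi>'_def)
  have "(\<lambda>n. cinner (k' (\<phi>' n)) (\<phi>' n) - cinner (\<phi>' n) (k' (\<phi>' n))) \<longlonglongrightarrow>
      cinner (k' \<phi>) \<phi> - cinner \<phi> (k' \<phi>)"
    by (intro tendsto_diff tendsto_cinner lim\<phi> limk)
  moreover have "cinner (k' (\<phi>' n)) (\<phi>' n) - cinner (\<phi>' n) (k' (\<phi>' n)) =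
      (\<mu> - cnj \<mu>) * complex_of_real ((norm (f n))\<^sup>2)" for n
    using green_f[OF f(1), of n n]
    by (simp add: \<Gamma>1_f f(2) \<phi>'_def cinner_scaleC_left cinner_scaleC_right cinner_self algebra_simps)
  moreover have "cinner (k' \<phi>) \<phi> - cinner \<phi> (k' \<phi>) = 0"
    using \<phi>(2) cinner_commute[of \<phi> "k' \<phi>"] k_eq[OF \<phi>(1)] by (simp add: complex_eq_iff)
  ultimately have "(\<lambda>n. (\<mu> - cnj \<mu>) * complex_of_real ((norm (f n))\<^sup>2)) \<longlonglongrightarrow> 0"
    by simp
  then have "(\<lambda>n. inverse (\<mu> - cnj \<mu>) * ((\<mu> - cnj \<mu>) * complex_of_real ((norm (f n))\<^sup>2))) \<longlonglongrightarrow> 0"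
    by (rule tendsto_mult_right_zero)
  moreover have "\<mu> - cnj \<mu> \<noteq> 0"
    using \<mu> Reals_cnj_iff by fastforce
  ultimately have "(\<lambda>n. complex_of_real ((norm (f n))\<^sup>2)) \<longlonglongrightarrow> 0"
    by (simp add: mult.assoc[symmetric])
  then have "(\<lambda>n. norm (complex_of_real ((norm (f n))\<^sup>2))) \<longlonglongrightarrow> 0"
    by (rule tendsto_norm_zero)
  then have "(\<lambda>n. sqrt ((norm (f n))\<^sup>2)) \<longlonglongrightarrow> sqrt 0"
    by (intro tendsto_real_sqrt) (simp add: norm_power)
  then have f_lim: "f \<longlonglongrightarrow> 0"
    by (simp add: tendsto_norm_zero_iff)
  have \<phi>_eq: "cinner (k' \<phi>) (\<Gamma>0 y) = cinner \<phi> (\<Gamma>1 y)" if "y \<in> T" for y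
  proof -
    obtain g g' where y: "y = (g, g')"
      by (cases y)
    have "(\<lambda>n. cinner (\<mu> *\<^sub>C f n) g - cinner (f n) g') \<longlonglongrightarrow> cinner (\<mu> *\<^sub>C 0) g - cinner 0 g'"
      by (intro tendsto_diff tendsto_cinner tendsto_scaleC tendsto_const f_lim)
    moreover have "(\<lambda>n. cinner (k' (\<phi>' n)) (\<Gamma>0 y) - cinner (\<phi>' n) (\<Gamma>1 y)) \<longlonglongrightarrow>
        cinner (k' \<phi>) (\<Gamma>0 y) - cinner \<phi> (\<Gamma>1 y)"
      by (intro tendsto_diff tendsto_cinner tendsto_const lim\<phi> limk)
    ultimately have "cinner (k' \<phi>) (\<Gamma>0 y) - cinner \<phi> (\<Gamma>1 y) = cinner (\<mu> *\<^sub>C 0) g - cinner 0 g'"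
      unfolding green_f[OF that[unfolded y]] y by (rule LIMSEQ_unique[THEN sym])
    then show ?thesis
      by simp
  qed
  \<comment> \<open>The joint density of both boundary maps allows \<open>\<Gamma>0\<close> to tend
    to 0 while \<open>\<Gamma>1\<close> tends to \<phi>; inserted into \<open>\<phi>_eq\<close> this
    gives \<open>cinner \<phi> \<phi> = 0\<close>.\<close>
  obtain y where y: "\<And>n. y n \<in> T" "(\<lambda>n. \<Gamma>0 (y n)) \<longlonglongrightarrow> 0" "(\<lambda>n. \<Gamma>1 (y n)) \<longlonglongrightarrow> \<phi>"
    using qbt_range_dense[OF csubspace_0[OF sG] \<phi>(1)] by metis
  have "(\<lambda>n. cinner (k' \<phi>) (\<Gamma>0 (y n))) \<longlonglongrightarrow> cinner (k' \<phi>) 0"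
    by (intro tendsto_cinner tendsto_const y)
  moreover have "(\<lambda>n. cinner \<phi> (\<Gamma>1 (y n))) \<longlonglongrightarrow> cinner \<phi> \<phi>"
    by (intro tendsto_cinner tendsto_const y)
  ultimately have "cinner \<phi> \<phi> = cinner (k' \<phi>) 0"
    using LIMSEQ_unique by (simp add: \<phi>_eq[OF y(1)])
  then show ?thesis
    by (simp add: cinner_self_eq_0)
qed

text \<open>In Green's identity between a defect element at \<open>cnj l\<close> and an element of
  the kernel of \<open>\<Gamma>0\<close>, one boundary term vanishes; what remains is the defining
  equation of the adjoint.\<close>

lemma gamma_adjoint_subset: "gamma_adjoint T \<Gamma>0 \<Gamma>1 l \<subseteq> adjoint_rel G H (gamma_field T \<Gamma>0 (cnj l))"
proof -
  have sH: "csubspace H"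
    using H by (simp add: hilbert_space_def)
  have "cinner f (h' - l *\<^sub>C h) = cinner \<phi> (\<Gamma>1 (h, h'))"
    if h: "(h, h') \<in> ker_on T \<Gamma>0" and f: "(\<phi>, f) \<in> gamma_field T \<Gamma>0 (cnj l)" for h h' \<phi> f
    using qbt_green[of f "cnj l *\<^sub>C f" h h'] h f
    by (simp add: gamma_field_iff ker_on_iff cinner_diff_right cinner_scaleC_left cinner_scaleC_right algebra_simps)
  then show ?thesis
    using qbt_subset qbt_mem csubspace_diff[OF sH] csubspace_scaleC[OF sH]
    by (auto simp: gamma_adjoint_def adjoint_rel_def ker_on_iff)
qed

lemma gamma_adjoint_Domain:
  assumes "l \<in> resolvent_set H (ker_on T \<Gamma>0)"
  shows "H \<subseteq> Domain (gamma_adjoint T \<Gamma>0 \<Gamma>1 l)"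
proof
  fix f assume "f \<in> H"
  then obtain h where "(h, f + l *\<^sub>C h) \<in> ker_on T \<Gamma>0"
    using resolvent_set_exists[OF assms] by blast
  then have "(f + l *\<^sub>C h - l *\<^sub>C h, \<Gamma>1 (h, f + l *\<^sub>C h)) \<in> gamma_adjoint T \<Gamma>0 \<Gamma>1 l"
    unfolding gamma_adjoint_def by blast
  then show "f \<in> Domain (gamma_adjoint T \<Gamma>0 \<Gamma>1 l)"
    by auto
qed

text \<open>Equality of adjoints is used without forming second adjoints:
  \<open>f - c \<phi>\<close> lies in the domain of the common adjoint, and pairing both
  \<open>f\<close> and \<open>c \<phi>\<close> with it gives the same number
  \<open>cinner \<phi> \<psi>\<close>. So \<open>f - c \<phi>\<close> is orthogonal to
  itself.\<close>

lemma gamma_field_subset: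
  assumes l: "l \<in> resolvent_set H (ker_on T \<Gamma>0)" and C: "C \<in> bounded_ops G H"
    and adj: "adjoint_rel G H (gamma_field T \<Gamma>0 l) = adjoint_rel G H C"
  shows "gamma_field T \<Gamma>0 l \<subseteq> C"
proof (rule subrelI)
  fix \<phi> f assume f: "(\<phi>, f) \<in> gamma_field T \<Gamma>0 l"
  obtain c where c: "C = graph_on G c" "\<And>x. x \<in> G \<Longrightarrow> c x \<in> H"
    using bounded_ops_graphE[OF C] by metis
  have \<phi>: "\<phi> \<in> G" and fH: "f \<in> H"
    using f qbt_mem qbt_subset by (auto simp: gamma_field_iff)
  have sH: "csubspace H"
    using H by (simp add: hilbert_space_def)
  have "f - c \<phi> \<in> H"
    using fH c(2)[OF \<phi>] csubspace_diff[OF sH] by blast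
  then obtain \<psi> where \<psi>: "(f - c \<phi>, \<psi>) \<in> gamma_adjoint T \<Gamma>0 \<Gamma>1 (cnj l)"
    using gamma_adjoint_Domain[OF selfadjoint_cnj_in_resolvent_set[OF H qbt_selfadjoint_kernel l]] by blast
  have adj1: "(f - c \<phi>, \<psi>) \<in> adjoint_rel G H (gamma_field T \<Gamma>0 l)"
    using \<psi> gamma_adjoint_subset[of "cnj l"] by auto
  then have "cinner f (f - c \<phi>) = cinner \<phi> \<psi>"
    using f by (auto simp: adjoint_rel_def)
  moreover have "cinner (c \<phi>) (f - c \<phi>) = cinner \<phi> \<psi>"
    using adj1 \<phi> unfolding adj by (auto simp: adjoint_rel_def c(1))
  ultimately have "cinner (f - c \<phi>) (f - c \<phi>) = 0"
    by (subst cinner_diff_left) simp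
  then show "(\<phi>, f) \<in> C"
    using \<phi> by (simp add: cinner_self_eq_0 c(1))
qed

lemma gamma_field_subset_comp:
  assumes l: "l \<in> resolvent_set H (ker_on T \<Gamma>0)"
  shows "gamma_field T \<Gamma>0 \<nu> \<subseteq> gamma_field T \<Gamma>0 l O id_plus_resolvent H (ker_on T \<Gamma>0) (\<nu> - l) \<nu>"
proof (rule subrelI)
  fix \<phi> f assume "(\<phi>, f) \<in> gamma_field T \<Gamma>0 \<nu>"
  then have f: "(f, \<nu> *\<^sub>C f) \<in> T" "\<phi> = \<Gamma>0 (f, \<nu> *\<^sub>C f)"
    by (auto simp: gamma_field_iff)
  obtain h where h: "(h, f + l *\<^sub>C h) \<in> ker_on T \<Gamma>0"
    using resolvent_set_exists[OF l qbt_subset(1)[OF f(1)]] by blast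
  \<comment> \<open>Here \<open>h\<close> is the resolvent of \<open>A0\<close> at \<open>l\<close>
    applied to \<open>f\<close>, and \<open>f1\<close> solves the defect equation at
    \<open>l\<close> with the boundary value of \<open>f\<close>. The identity
    \<open>f1 + \<nu> *\<^sub>C h = f + l *\<^sub>C h\<close> shows that \<open>h\<close> also
    solves the resolvent equation at \<nu> for \<open>f1\<close>, which recovers
    \<open>f\<close>.\<close>
  define f1 where "f1 = f - (\<nu> - l) *\<^sub>C h"
  have smult: "(c *\<^sub>C h, c *\<^sub>C (f + l *\<^sub>C h)) \<in> ker_on T \<Gamma>0" for c
    using csubspace_scaleC[OF selfadjoint_relation_csubspace[OF qbt_selfadjoint_kernel] h, of c] by (simp add: scaleC_prod_def)
  have f1_eq: "(f1, l *\<^sub>C f1) = (f, \<nu> *\<^sub>C f) - ((\<nu> - l) *\<^sub>C h, (\<nu> - l) *\<^sub>C (f + l *\<^sub>C h))"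
    by (simp add: f1_def scaleC_diff_right scaleC_diff_left scaleC_add_right scaleC_scaleC mult.commute
        right_diff_distrib left_diff_distrib)
  have "(f1, l *\<^sub>C f1) \<in> T"
    unfolding f1_eq using f(1) smult by (intro csubspace_diff[OF qbt_csubspace]) (auto simp: ker_on_iff)
  moreover have "\<Gamma>0 (f1, l *\<^sub>C f1) = \<phi>"
    unfolding f1_eq using f smult[of "\<nu> - l"] by (subst qbt_diff0) (auto simp: ker_on_iff)
  ultimately have "(\<phi>, f1) \<in> gamma_field T \<Gamma>0 l"
    by (simp add: gamma_field_iff)
  moreover have "f1 + \<nu> *\<^sub>C h = f + l *\<^sub>C h"
    by (simp add: f1_def scaleC_diff_left)
  then have "(f1, f1 + (\<nu> - l) *\<^sub>C h) \<in> id_plus_resolvent H (ker_on T \<Gamma>0) (\<nu> - l) \<nu>"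
    using h qbt_subset(1)[OF \<open>(f1, l *\<^sub>C f1) \<in> T\<close>] unfolding id_plus_resolvent_def by auto
  then have "(f1, f) \<in> id_plus_resolvent H (ker_on T \<Gamma>0) (\<nu> - l) \<nu>"
    by (simp add: f1_def)
  ultimately show "(\<phi>, f) \<in> gamma_field T \<Gamma>0 l O id_plus_resolvent H (ker_on T \<Gamma>0) (\<nu> - l) \<nu>"
    by blast
qed

text \<open>The adjoint equation extends from the dense range of \<open>\<Gamma>0\<close> to
  \<open>G\<close> by continuity of \<open>C\<close>. Conversely \<open>gamma_adjoint\<close> is
  defined on all of \<open>H\<close>, while the adjoint of the everywhere defined \<open>C\<close>
  is single-valued.\<close>

lemma gamma_adjoint_eq:
  assumes l: "l \<in> resolvent_set H (ker_on T \<Gamma>0)" and C: "C \<in> bounded_ops G H"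
    and sub: "gamma_field T \<Gamma>0 (cnj l) \<subseteq> C"
  shows "gamma_adjoint T \<Gamma>0 \<Gamma>1 l = adjoint_rel G H C"
proof -
  have sG: "csubspace G"
    using qbt_boundary_space by (simp add: hilbert_space_def)
  obtain c b where c: "C = graph_on G c" "\<And>x. x \<in> G \<Longrightarrow> c x \<in> H" "clinear_on G c"
    "\<And>x. x \<in> G \<Longrightarrow> norm (c x) \<le> b * norm x"
    using bounded_ops_graphE[OF C] by metis
  have sub': "gamma_adjoint T \<Gamma>0 \<Gamma>1 l \<subseteq> adjoint_rel G H C"
  proof (rule subrelI)
    fix f \<psi> assume mem: "(f, \<psi>) \<in> gamma_adjoint T \<Gamma>0 \<Gamma>1 l"
    then have adj: "(f, \<psi>) \<in> adjoint_rel G H (gamma_field T \<Gamma>0 (cnj l))"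
      using gamma_adjoint_subset by blast
    have "cinner (c \<phi>) f = cinner \<phi> \<psi>" if \<phi>: "\<phi> \<in> G" for \<phi>
    proof -
      obtain x where x: "\<And>n. x n \<in> T" "(\<lambda>n. \<Gamma>0 (x n)) \<longlonglongrightarrow> \<phi>"
        using qbt_range_dense[OF \<phi> csubspace_0[OF sG]] by metis
      have "cinner (c (\<Gamma>0 (x n))) f = cinner (\<Gamma>0 (x n)) \<psi>" for n
      proof -
        obtain g where g: "(g, cnj l *\<^sub>C g) \<in> T" "\<Gamma>0 (g, cnj l *\<^sub>C g) = \<Gamma>0 (x n)"
          using defect_decomposition[OF selfadjoint_cnj_in_resolvent_set[OF H qbt_selfadjoint_kernel l] x(1)] by blast
        then have "(\<Gamma>0 (x n), g) \<in> gamma_field T \<Gamma>0 (cnj l)"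
          by (simp add: gamma_field_iff)
        then have "cinner g f = cinner (\<Gamma>0 (x n)) \<psi>" "g = c (\<Gamma>0 (x n))"
          using adj sub by (auto simp: adjoint_rel_def c(1))
        then show ?thesis
          by simp
      qed
      moreover have "(\<lambda>n. cinner (c (\<Gamma>0 (x n))) f) \<longlonglongrightarrow> cinner (c \<phi>) f"
        by (intro tendsto_cinner tendsto_const bounded_clinear_tendsto[OF c(3) sG c(4) qbt_mem(1)[OF x(1)] x(2) \<phi>])
      ultimately have "(\<lambda>n. cinner (\<Gamma>0 (x n)) \<psi>) \<longlonglongrightarrow> cinner (c \<phi>) f"
        by simp
      moreover have "(\<lambda>n. cinner (\<Gamma>0 (x n)) \<psi>) \<longlonglongrightarrow> cinner \<phi> \<psi>"
        by (intro tendsto_cinner tendsto_const x)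
      ultimately show ?thesis
        by (rule LIMSEQ_unique)
    qed
    then show "(f, \<psi>) \<in> adjoint_rel G H C"
      using adj by (auto simp: adjoint_rel_def c(1))
  qed
  moreover have "adjoint_rel G H C \<subseteq> gamma_adjoint T \<Gamma>0 \<Gamma>1 l"
  proof (rule subrelI)
    fix f \<psi> assume f: "(f, \<psi>) \<in> adjoint_rel G H C"
    then have "f \<in> H"
      by (simp add: adjoint_rel_def)
    then obtain \<psi>' where \<psi>': "(f, \<psi>') \<in> gamma_adjoint T \<Gamma>0 \<Gamma>1 l"
      using gamma_adjoint_Domain[OF l] by blast
    have "Domain C = G"
      using c(1) by auto
    then have "\<psi> = \<psi>'"
      using adjoint_rel_single_valued[OF sG] f \<psi>' sub' by (metis single_valuedD subsetD)
    then show "(f, \<psi>) \<in> gamma_adjoint T \<Gamma>0 \<Gamma>1 l"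
      using \<psi>' by simp
  qed
  ultimately show ?thesis
    by blast
qed

text \<open>A version of Krein's resolvent formula in which the Weyl function is taken at a point \<open>\<mu>\<close> that
  may differ from the spectral parameter \<open>l\<close>.\<close>

lemma resolvent_difference_subset:
  assumes l: "l \<in> resolvent_set H (extension_rel T \<Gamma>0 \<Gamma>1 \<Theta>)"
    and \<mu>: "\<mu> \<in> resolvent_set H (extension_rel T \<Gamma>0 \<Gamma>1 \<Theta>)"
    and s: "csubspace (extension_rel T \<Gamma>0 \<Gamma>1 \<Theta>)"
    and K: "weyl_function T \<Gamma>0 \<Gamma>1 \<mu> \<subseteq> graph_on G k"
  shows "diff_op ((shift_rel (extension_rel T \<Gamma>0 \<Gamma>1 \<Theta>) l)\<inverse>) ((shift_rel (ker_on T \<Gamma>0) l)\<inverse>) \<subseteq>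
    gamma_adjoint T \<Gamma>0 \<Gamma>1 l O {(\<theta> - k \<phi>, \<phi>) | \<phi> \<theta>. (\<phi>, \<theta>) \<in> \<Theta>} O gamma_field T \<Gamma>0 \<mu> O
      id_plus_resolvent H (extension_rel T \<Gamma>0 \<Gamma>1 \<Theta>) (l - \<mu>) l"
    (is "_ \<subseteq> _ O ?B O _ O ?R")
proof (rule subrelI)
  define S where "S = extension_rel T \<Gamma>0 \<Gamma>1 \<Theta>"
  have S_iff: "x \<in> S \<longleftrightarrow> x \<in> T \<and> (\<Gamma>0 x, \<Gamma>1 x) \<in> \<Theta>" for x
    by (simp add: S_def extension_rel_def)
  have sH: "csubspace H"
    using H by (simp add: hilbert_space_def)
  fix f y assume "(f, y) \<in> diff_op ((shift_rel (extension_rel T \<Gamma>0 \<Gamma>1 \<Theta>) l)\<inverse>) ((shift_rel (ker_on T \<Gamma>0) l)\<inverse>)"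
  then obtain g h where y: "y = g - h" and g: "(g, f + l *\<^sub>C g) \<in> S" and h: "(h, f + l *\<^sub>C h) \<in> ker_on T \<Gamma>0"
    unfolding diff_op_def S_def[symmetric] by (auto simp: converse_shift_rel_iff simp del: converse_iff)
  define h' where "h' = f + l *\<^sub>C h"
  have hH: "h \<in> H" "h' \<in> H" and hT: "(h, h') \<in> T" and h0: "\<Gamma>0 (h, h') = 0"
    using h qbt_subset by (auto simp: ker_on_iff h'_def)
  have "h' - \<mu> *\<^sub>C h \<in> H"
    using hH by (intro csubspace_diff[OF sH] csubspace_scaleC[OF sH])
  \<comment> \<open>The element \<open>g1\<close> is chosen so that \<open>g1\<close> and
    \<open>h\<close> have the same image after shifting by \<mu>, one in the extension and one in
    \<open>A0\<close>. Their difference \<open>z\<close> is then a defect vector at \<mu>, the point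
    where the Weyl function is controlled.\<close>
  then obtain g1 where g1: "(g1, h' - \<mu> *\<^sub>C h + \<mu> *\<^sub>C g1) \<in> S"
    using resolvent_set_exists[OF \<mu>] unfolding S_def by blast
  define z where "z = g1 - h"
  define \<phi> where "\<phi> = \<Gamma>0 (g1, h' - \<mu> *\<^sub>C h + \<mu> *\<^sub>C g1)"
  define \<theta> where "\<theta> = \<Gamma>1 (g1, h' - \<mu> *\<^sub>C h + \<mu> *\<^sub>C g1)"
  have z_eq: "(z, \<mu> *\<^sub>C z) = (g1, h' - \<mu> *\<^sub>C h + \<mu> *\<^sub>C g1) - (h, h')"
    by (simp add: z_def scaleC_diff_right)
  have g1T: "(g1, h' - \<mu> *\<^sub>C h + \<mu> *\<^sub>C g1) \<in> T" and \<Theta>: "(\<phi>, \<theta>) \<in> \<Theta>"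
    using g1 by (auto simp: S_iff \<phi>_def \<theta>_def)
  have zT: "(z, \<mu> *\<^sub>C z) \<in> T"
    unfolding z_eq by (rule csubspace_diff[OF qbt_csubspace g1T hT])
  have \<Gamma>z: "\<Gamma>0 (z, \<mu> *\<^sub>C z) = \<phi>" "\<Gamma>1 (z, \<mu> *\<^sub>C z) = \<theta> - \<Gamma>1 (h, h')"
    unfolding z_eq qbt_diff0[OF g1T hT] qbt_diff1[OF g1T hT] by (simp_all add: \<phi>_def \<theta>_def h0)
  then have "(\<phi>, \<theta> - \<Gamma>1 (h, h')) \<in> weyl_function T \<Gamma>0 \<Gamma>1 \<mu>"
    unfolding weyl_function_iff using zT by metis
  then have "k \<phi> = \<theta> - \<Gamma>1 (h, h')"
    using K by auto
  then have "\<Gamma>1 (h, h') = \<theta> - k \<phi>"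
    by simp
  then have B: "(\<Gamma>1 (h, h'), \<phi>) \<in> ?B"
    using \<Theta> by blast
  have Q: "(f, \<Gamma>1 (h, h')) \<in> gamma_adjoint T \<Gamma>0 \<Gamma>1 l"
    unfolding gamma_adjoint_def using h by (force simp: h'_def)
  have \<gamma>: "(\<phi>, z) \<in> gamma_field T \<Gamma>0 \<mu>"
    using zT \<Gamma>z by (simp add: gamma_field_iff)
  have zH: "z \<in> H"
    using qbt_subset zT by blast
  \<comment> \<open>The correction from \<mu> to \<open>l\<close>: adding
    \<open>(l - \<mu>) *\<^sub>C w\<close> to \<open>g1\<close> turns the equation at \<mu> into the
    one at \<open>l\<close> that \<open>g\<close> solves, and uniqueness of the solution identifies
    the two.\<close>
  obtain w where w: "(w, z + l *\<^sub>C w) \<in> S"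
    using resolvent_set_exists[OF l zH] unfolding S_def by blast
  have "((l - \<mu>) *\<^sub>C w, (l - \<mu>) *\<^sub>C (z + l *\<^sub>C w)) \<in> S"
    using csubspace_scaleC[OF s, of "(w, z + l *\<^sub>C w)" "l - \<mu>"] w by (simp add: scaleC_prod_def S_def)
  from csubspace_add[OF s g1[unfolded S_def] this[unfolded S_def]]
  have "(g1 + (l - \<mu>) *\<^sub>C w, f + l *\<^sub>C (g1 + (l - \<mu>) *\<^sub>C w)) \<in> S"
    by (simp add: S_def h'_def z_def scaleC_diff_right scaleC_diff_left scaleC_add_right scaleC_scaleC
        algebra_simps)
  then have "g = g1 + (l - \<mu>) *\<^sub>C w"
    using resolvent_set_unique[OF l] g unfolding S_def by metis
  then have "y = z + (l - \<mu>) *\<^sub>C w"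
    by (simp add: y z_def)
  then have R: "(z, y) \<in> ?R"
    using w zH unfolding id_plus_resolvent_def S_def by auto
  show "(f, y) \<in> gamma_adjoint T \<Gamma>0 \<Gamma>1 l O ?B O gamma_field T \<Gamma>0 \<mu> O ?R"
    using Q B \<gamma> R by blast
qed

end

section \<open>The resolvent difference\<close>

theorem theorem3p15:
  fixes H G :: "'a::complex_inner set"
    and A T \<Theta> A0 A\<Theta> :: "('a \<times> 'a) set"
    and \<Gamma>0 \<Gamma>1 :: "'a \<times> 'a \<Rightarrow> 'a"
    and \<gamma> M :: "complex \<Rightarrow> ('a \<times> 'a) set"
    and \<AA> :: "'a op_class"
  defines "A0 \<equiv> ker_on T \<Gamma>0"
    and "\<gamma> \<equiv> gamma_field T \<Gamma>0"
    and "M \<equiv> weyl_function T \<Gamma>0 \<Gamma>1"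
    and "A\<Theta> \<equiv> extension_rel T \<Gamma>0 \<Gamma>1 \<Theta>"
  assumes "separable_hilbert_space H"
    and "closed_symmetric_relation H A"
    and "quasi_boundary_triple H A G T \<Gamma>0 \<Gamma>1"
    and "operator_ideal_class \<AA>"
    and "selfadjoint_relation G \<Theta>"
    and "\<exists>l0. l0 \<notin> \<real> \<and> closure (M l0) \<in> compact_ops G G"
    and "\<exists>l1 \<in> resolvent_set H A0. adjoint_rel G H (\<gamma> l1) \<in> adjoint_class \<AA> H G"
    and "0 \<notin> essential_spectrum \<Theta>"
    and "A\<Theta> = adjoint_rel H H A\<Theta>"
  shows "\<forall>l \<in> resolvent_set H A\<Theta> \<inter> resolvent_set H A0.
    diff_op ((shift_rel A\<Theta> l)\<inverse>) ((shift_rel A0 l)\<inverse>) \<in> product_class \<AA> (adjoint_class \<AA>) H H"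
proof
  fix l assume l: "l \<in> resolvent_set H A\<Theta> \<inter> resolvent_set H A0"
  have H: "hilbert_space H"
    using assms(5) by (simp add: separable_hilbert_space_def)
  then have sH: "csubspace H"
    by (simp add: hilbert_space_def)
  note triple = H assms(7)
  note G = qbt_boundary_space[OF triple] and A0 = qbt_selfadjoint_kernel[OF triple]
  have sG: "csubspace G"
    using G by (simp add: hilbert_space_def)
  have A\<Theta>: "selfadjoint_relation H A\<Theta>"
  proof -
    have "csubspace A\<Theta>"
      by (subst assms(13)) (rule csubspace_adjoint_rel[OF sH sH])
    moreover have "A\<Theta> \<subseteq> H \<times> H"
      by (subst assms(13)) (auto simp: adjoint_rel_def)
    ultimately show ?thesis
      using assms(13) by (simp add: selfadjoint_relation_def linear_relation_def)
  qed
  obtain \<mu> where \<mu>: "\<mu> \<notin> \<real>" and M: "closure (M \<mu>) \<in> compact_ops G G"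
    using assms(10) by blast
  then have "closure (M \<mu>) \<in> bounded_ops G G"
    by (simp add: compact_ops_def)
  then obtain k where k: "closure (M \<mu>) = graph_on G k"
    using bounded_ops_graphE by metis
  have K: "graph_on G k \<in> compact_ops G G"
    using M k by simp
  have strict: "\<phi> = 0" if "\<phi> \<in> G" "Im (cinner (k \<phi>) \<phi>) = 0" for \<phi>
    using weyl_function_strict[OF triple, OF \<mu>, of k \<phi>] that k K by (simp add: M_def compact_ops_def)
  \<comment> \<open>Needed before any ideal rule can be used with \<open>G\<close> as one of the
    spaces.\<close>
  have sepG: "separable_hilbert_space G"
    using separable_hilbert_space_if_compact_op[OF G K] strict by simp
  note ideal = assms(8)[unfolded operator_ideal_class_def, rule_format]
  have ideal_bounded: "X \<in> bounded_ops U V"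
    if "X \<in> \<AA> U V" "separable_hilbert_space U" "separable_hilbert_space V" for X U V
    using ideal[OF that(2,3)] that(1) by (auto simp: compact_ops_def)
  have ideal_comp: "B O X O C \<in> \<AA> U' V'"
    if "X \<in> \<AA> U V" "B \<in> bounded_ops U' U" "C \<in> bounded_ops V V'" "separable_hilbert_space U"
      "separable_hilbert_space V" "separable_hilbert_space U'" "separable_hilbert_space V'" for B X C U V U' V'
    using ideal[OF that(4,5)] that by blast
  \<comment> \<open>The adjoint class only provides some ideal operator \<open>X\<close> with the
    same adjoint; that \<open>X\<close> extends \<open>\<gamma> l1\<close> still has to be
    shown.\<close>
  obtain l1 X where l1: "l1 \<in> resolvent_set H A0" and X: "X \<in> \<AA> G H"
    and adjX: "adjoint_rel G H (\<gamma> l1) = adjoint_rel G H X"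
    using assms(11) by (auto simp: adjoint_class_def)
  have \<gamma>X: "\<gamma> l1 \<subseteq> X"
    using gamma_field_subset[OF triple] l1 ideal_bounded[OF X sepG assms(5)] adjX by (simp add: A0_def \<gamma>_def)
  \<comment> \<open>The ideal rule takes a bounded factor on either side; the identity fills the
    side where nothing is to be multiplied.\<close>
  have "graph_on G (\<lambda>x. x) \<in> bounded_ops G G"
    by (rule bounded_ops_graphI[OF sG, where c = 1]) (auto simp: clinear_on_def)
  \<comment> \<open>For \<nu> in the resolvent set of \<open>A0\<close> this is an ideal operator
    extending \<open>\<gamma> \<nu>\<close>. It is used at \<mu> for the left factor and at
    \<open>cnj l\<close> for the adjoint factor.\<close>
  define C where "C \<nu> = X O id_plus_resolvent H A0 (\<nu> - l1) \<nu>" for \<nu>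
  have C: "C \<nu> \<in> \<AA> G H" if "\<nu> \<in> resolvent_set H A0" for \<nu>
  proof -
    have "graph_on G (\<lambda>x. x) O X O id_plus_resolvent H A0 (\<nu> - l1) \<nu> \<in> \<AA> G H"
      using X \<open>graph_on G (\<lambda>x. x) \<in> bounded_ops G G\<close> id_plus_resolvent_bounded[OF sH that] sepG assms(5)
      by (intro ideal_comp)
    moreover have "X \<subseteq> G \<times> H"
      using ideal_bounded[OF X sepG assms(5)] by (auto simp: bounded_ops_def linear_relation_def)
    then have "graph_on G (\<lambda>x. x) O X = X"
      by (auto simp: relcomp_unfold)
    ultimately show ?thesis
      by (simp add: C_def O_assoc[symmetric])
  qed
  have \<gamma>C: "\<gamma> \<nu> \<subseteq> C \<nu>" for \<nu>
    using gamma_field_subset_comp[OF triple, of l1 \<nu>] l1 \<gamma>X unfolding C_def \<gamma>_def A0_def by blast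
  have \<mu>_res: "\<mu> \<in> resolvent_set H A0" "\<mu> \<in> resolvent_set H A\<Theta>"
    using nonreal_in_resolvent_set[OF H _ \<mu>] A\<Theta> A0 by (auto simp: A0_def)
  have cnj_l: "cnj l \<in> resolvent_set H A0"
    using selfadjoint_cnj_in_resolvent_set[OF H A0] l by (simp add: A0_def)
  define B where "B = {(\<theta> - k \<phi>, \<phi>) | \<phi> \<theta>. (\<phi>, \<theta>) \<in> \<Theta>}"
  have B: "B \<in> bounded_ops G G"
    unfolding B_def using fredholm_minus_compact_inverse_bounded[OF G assms(9,12) K] strict by blast
  define R where "R = id_plus_resolvent H A\<Theta> (l - \<mu>) l"
  have R: "R \<in> bounded_ops H H"
    unfolding R_def using id_plus_resolvent_bounded[OF sH] l by blast
  have F: "B O C \<mu> O R \<in> \<AA> G H"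
    using C[OF \<mu>_res(1)] B R sepG assms(5) by (intro ideal_comp)
  have Q: "gamma_adjoint T \<Gamma>0 \<Gamma>1 l = adjoint_rel G H (C (cnj l))"
    using gamma_adjoint_eq[OF triple] l ideal_bounded[OF C[OF cnj_l] sepG assms(5)] \<gamma>C
    by (simp add: A0_def \<gamma>_def)
  have Q_sv: "single_valued (gamma_adjoint T \<Gamma>0 \<Gamma>1 l)"
  proof -
    have "Domain (C (cnj l)) = G"
      using ideal_bounded[OF C[OF cnj_l] sepG assms(5)] by (simp add: bounded_ops_def)
    then show ?thesis
      unfolding Q by (rule adjoint_rel_single_valued[OF sG])
  qed
  define D where "D = diff_op ((shift_rel A\<Theta> l)\<inverse>) ((shift_rel A0 l)\<inverse>)"
  have "D \<subseteq> gamma_adjoint T \<Gamma>0 \<Gamma>1 l O B O gamma_field T \<Gamma>0 \<mu> O R"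
    unfolding D_def A0_def A\<Theta>_def B_def R_def
    using l \<mu>_res(2) selfadjoint_relation_csubspace[OF A\<Theta>] k closure_subset[of "M \<mu>"]
    by (intro resolvent_difference_subset[OF triple]) (auto simp: A\<Theta>_def M_def)
  then have D_sub: "D \<subseteq> gamma_adjoint T \<Gamma>0 \<Gamma>1 l O (B O C \<mu> O R)"
    using \<gamma>C[of \<mu>] unfolding \<gamma>_def by blast
  \<comment> \<open>Since \<open>l\<close> lies in both resolvent sets, \<open>D\<close> has a value
    at every vector of \<open>H\<close>; the product is single-valued, so the inclusion
    \<open>D_sub\<close> leaves it no further pairs.\<close>
  have "gamma_adjoint T \<Gamma>0 \<Gamma>1 l O (B O C \<mu> O R) \<subseteq> D"
  proof (rule subrelI)
    fix f y assume fy: "(f, y) \<in> gamma_adjoint T \<Gamma>0 \<Gamma>1 l O (B O C \<mu> O R)"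
    then have "f \<in> H"
      unfolding Q by (auto simp: adjoint_rel_def)
    obtain g where g: "(g, f + l *\<^sub>C g) \<in> A\<Theta>"
      using l \<open>f \<in> H\<close> by (auto elim: resolvent_set_exists)
    obtain h where h: "(h, f + l *\<^sub>C h) \<in> A0"
      using l \<open>f \<in> H\<close> by (auto elim: resolvent_set_exists)
    from g h have "(f, g - h) \<in> D"
      unfolding D_def diff_op_def converse_shift_rel_iff by blast
    moreover have "single_valued (gamma_adjoint T \<Gamma>0 \<Gamma>1 l O (B O C \<mu> O R))"
      using Q_sv ideal_bounded[OF F sepG assms(5)]
      by (intro single_valued_relcomp[of "gamma_adjoint T \<Gamma>0 \<Gamma>1 l"]) (simp_all add: bounded_ops_def)
    ultimately show "(f, y) \<in> D"
      using D_sub fy by (metis single_valuedD subsetD)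
  qed
  then have "D = gamma_adjoint T \<Gamma>0 \<Gamma>1 l O (B O C \<mu> O R)"
    using D_sub by blast
  moreover have "gamma_adjoint T \<Gamma>0 \<Gamma>1 l \<in> adjoint_class \<AA> H G"
    unfolding Q adjoint_class_def using C[OF cnj_l] by blast
  ultimately show "diff_op ((shift_rel A\<Theta> l)\<inverse>) ((shift_rel A0 l)\<inverse>) \<in>
      product_class \<AA> (adjoint_class \<AA>) H H"
    unfolding product_class_def D_def[symmetric] using F sepG by blast
qed

end
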